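(* Assume the censored parametric regression model described in the context, with true parameter $\vartheta_0\in\Theta$. Suppose that (a) $|L_{G,H}(\vartheta_0,\vartheta_0)|<\infty$; (b) $\mathbb{P}\big((X,Y)\in A_{\vartheta_0,\vartheta}\big)>0$ for all $\vartheta\in\Theta\setminus\{\vartheta_0\}$; (c) the densities are continuous in the parameter: for all $x\in\mathbb{R}^p$ and $y\in[0,\infty)$ the map $\vartheta\mapsto f(y\mid\vartheta,x)$ is continuous on $\Theta$; (d) $\Theta$ is compact; (e) for every $\vartheta^*\in\Theta$ there exists an open neighborhood $V^*=V(\vartheta^* )$ of $\vartheta^*$ in $\Theta$ such that $\mathbb{E}\big[\sup_{\vartheta\in V^*}\ell_1(\vartheta)\big]<\infty$. Let $\hat\vartheta_n$ be a maximizer over $\Theta$ of $\ell_n(\cdot)$. Then $\hat\vartheta_n\to\vartheta_0$ as $n\to\infty$ with probability one.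
   Context: Setting. Let $\nu$ be a $\sigma$-finite measure on $[0,\infty)$, $\Theta\subseteq\mathbb{R}^q$, and let $\mathcal{F}=\{f(\cdot\mid\vartheta,\cdot):\vartheta\in\Theta\}$ be a parametric family of conditional densities with respect to $\nu$: $f:\mathbb{R}^p\times[0,\infty)\ni(x,y)\mapsto f(y\mid\vartheta,x)\in(0,\infty)$, with $\int f(y\mid\vartheta,x)\,\nu(dy)=1$. The densities are strictly positive for $(H\times\nu)$-a.e. $(x,y)$ and all $\vartheta\in\Theta$. Let $F(c\mid\vartheta,x)=\int_{-\infty}^c f(y\mid\vartheta,x)\,\nu(dy)$ be the corresponding conditional distribution function (the integral $\int_{-\infty}^c$ is over $y\le c$). $X$ is a random vector in $\mathbb{R}^p$ with distribution function $H$; $Y\ge 0$ and $C\ge 0$ are random variables, conditionally independent given $X$; the conditional distribution of $Y$ given $X=x$ has density $f(\cdot\mid\vartheta_0,x)$ with respect to $\nu$, where $\vartheta_0\in\Theta$ is the true parameter; $G(\cdot\mid x)$ is the conditional distribution function of $C$ given $X=x$, and $G(y-\mid x)$ denotes its left limit at $y$. Put $Z=\min(Y,C)$, $\delta=1_{\{Y\le C\}}$. One observes i.i.d. copies $(X_i,Z_i,\delta_i)$, $i=1,2,\dots$, of $(X,Z,\delta)$. Log-likelihood: $$\ell_n(\vartheta)=\sum_{i=1}^n \Big[\delta_i\log f(Z_i\mid\vartheta,X_i)+(1-\delta_i)\log\big(1-F(Z_i\mid\vartheta,X_i)\big)\Big],$$ where $(1-\delta_i)\log(1-F(Z_i\mid\vartheta,X_i))$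 is defined to be $0$ if $F(Z_i\mid\vartheta,X_i)=1$. In particular $\ell_1(\vartheta)$ is the log-likelihood of a single observation. Define $$L_{G,H}(\vartheta_0,\vartheta)=\int\int\Big[\int_{-\infty}^c\log(f(y\mid\vartheta,x))f(y\mid\vartheta_0,x)\,\nu(dy)+(1-F(c\mid\vartheta_0,x))\log(1-F(c\mid\vartheta,x))\Big]G(dc\mid x)\,H(dx),$$ which equals $\mathbb{E}[\ell_1(\vartheta)]$ when this expectation exists (with the same convention when $F=1$), and $$A_{\vartheta_1,\vartheta_2}=\Big\{(x,y):\ \frac{f(y\mid\vartheta_1,x)}{f(y\mid\vartheta_2,x)}\neq 1,\ G(y-\mid x)<1\Big\}.$$ If measurability problems arise because of suprema over uncountable sets, "with probability one" is understood in terms of inner probability. *)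

theory Defs
  imports "HOL-Probability.Probability"
begin

text \<open>
  Integral of an extended-real function as the difference of the integrals of its positive and
  negative part. Since \<open>\<infinity> - \<infinity> = \<infinity>\<close> for \<open>ereal\<close>, an integral that does not exist has the value
  \<open>\<infinity>\<close>: the assertions \<open>ext_integral M u < \<infinity>\<close> and \<open>\<bar>ext_integral M u\<bar> < \<infinity>\<close> both include its existence.
\<close>

definition ext_integral :: "'a measure \<Rightarrow> ('a \<Rightarrow> ereal) \<Rightarrow> ereal" where
  "ext_integral M u =
     enn2ereal (\<integral>\<^sup>+ x. e2ennreal (u x) \<partial>M) - enn2ereal (\<integral>\<^sup>+ x. e2ennreal (- u x) \<partial>M)"

definition is_cond_distr ::
  "'w measure \<Rightarrow> ('w \<Rightarrow> 'x::topological_space) \<Rightarrow> ('w \<Rightarrow> real) \<Rightarrow> ('x \<Rightarrow> real measure) \<Rightarrow> bool" where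
  "is_cond_distr M X Y K \<longleftrightarrow>
     K \<in> measurable borel (prob_algebra borel) \<and>
     (\<forall>B\<in>sets borel. AE w in M.
        real_cond_exp M (vimage_algebra (space M) X borel) (indicat_real (Y -` B \<inter> space M)) w
          = measure (K (X w)) B)"

definition cond_indep ::
  "'w measure \<Rightarrow> ('w \<Rightarrow> 'x::topological_space) \<Rightarrow> ('w \<Rightarrow> real) \<Rightarrow> ('w \<Rightarrow> real) \<Rightarrow> bool" where
  "cond_indep M X Y C \<longleftrightarrow>
     (let S = vimage_algebra (space M) X borel in
      \<forall>B\<in>sets borel. \<forall>D\<in>sets borel. AE w in M.
        real_cond_exp M S (indicat_real (Y -` B \<inter> C -` D \<inter> space M)) w
          = real_cond_exp M S (indicat_real (Y -` B \<inter> space M)) w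
            * real_cond_exp M S (indicat_real (C -` D \<inter> space M)) w)"

text \<open>
  The dominating measure \<open>nu\<close> on \<open>[0, \<infinity>)\<close> is a Borel measure on the real line for which the negative
  half-line is a null set; the values of \<open>f t x y\<close> for \<open>y < 0\<close> play no role.
  The density written \<open>f(y | t, x)\<close> is \<open>f t x y\<close>; zeros of the density, where
  \<open>ln 0 = 0\<close> by convention, occur only on a null set.
\<close>

definition density_family ::
  "real measure \<Rightarrow> (real^'p) measure \<Rightarrow> (real^'q) set
    \<Rightarrow> (real^'q \<Rightarrow> real^'p \<Rightarrow> real \<Rightarrow> real) \<Rightarrow> bool" where
  "density_family nu H \<Theta> f \<longleftrightarrow>
     (\<forall>t\<in>\<Theta>. (\<lambda>(x, y). f t x y) \<in> borel_measurable (borel \<Otimes>\<^sub>M borel)) \<and>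
     (\<forall>t\<in>\<Theta>. \<forall>x. \<forall>y\<ge>0. 0 \<le> f t x y) \<and>
     (\<forall>t\<in>\<Theta>. \<forall>x. (\<integral>\<^sup>+ y. ennreal (f t x y) \<partial>nu) = 1) \<and>
     (AE (x, y) in H \<Otimes>\<^sub>M nu. \<forall>t\<in>\<Theta>. 0 < f t x y)"

definition cond_cdf ::
  "real measure \<Rightarrow> ('t \<Rightarrow> 'x \<Rightarrow> real \<Rightarrow> real) \<Rightarrow> 't \<Rightarrow> 'x \<Rightarrow> real \<Rightarrow> real" where
  "cond_cdf nu f t x c = (LINT y:{..c}|nu. f t x y)"

definition log_surv ::
  "real measure \<Rightarrow> ('t \<Rightarrow> 'x \<Rightarrow> real \<Rightarrow> real) \<Rightarrow> 't \<Rightarrow> 'x \<Rightarrow> real \<Rightarrow> real" where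
  "log_surv nu f t x c = (if cond_cdf nu f t x c = 1 then 0 else ln (1 - cond_cdf nu f t x c))"

text \<open>The observations are numbered from \<open>0\<close>.\<close>

definition loglik ::
  "real measure \<Rightarrow> ('t \<Rightarrow> 'x \<Rightarrow> real \<Rightarrow> real) \<Rightarrow> (nat \<Rightarrow> 'w \<Rightarrow> 'x) \<Rightarrow> (nat \<Rightarrow> 'w \<Rightarrow> real)
    \<Rightarrow> (nat \<Rightarrow> 'w \<Rightarrow> real) \<Rightarrow> nat \<Rightarrow> 'w \<Rightarrow> 't \<Rightarrow> real" where
  "loglik nu f Xs Zs ds n w t =
     (\<Sum>i<n. ds i w * ln (f t (Xs i w) (Zs i w)) + (1 - ds i w) * log_surv nu f t (Xs i w) (Zs i w))"

text \<open>\<open>G x\<close> is the conditional law of the censoring variable, with distribution function \<open>cdf (G x)\<close>.\<close>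

definition L_fun ::
  "real measure \<Rightarrow> ('t \<Rightarrow> 'x \<Rightarrow> real \<Rightarrow> real) \<Rightarrow> ('x \<Rightarrow> real measure) \<Rightarrow> 'x measure
    \<Rightarrow> 't \<Rightarrow> 't \<Rightarrow> ereal" where
  "L_fun nu f G H t0 t =
     ext_integral H (\<lambda>x. ext_integral (G x) (\<lambda>c.
       ext_integral nu (\<lambda>y. ereal (indicat_real {..c} y * (ln (f t x y) * f t0 x y)))
       + ereal ((1 - cond_cdf nu f t0 x c) * log_surv nu f t x c)))"

definition A_set ::
  "('t \<Rightarrow> 'x \<Rightarrow> real \<Rightarrow> real) \<Rightarrow> ('x \<Rightarrow> real measure) \<Rightarrow> 't \<Rightarrow> 't \<Rightarrow> ('x \<times> real) set" where
  "A_set f G t1 t2 =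
     {(x, y). 0 \<le> y \<and> f t1 x y / f t2 x y \<noteq> 1 \<and> Lim (at_left y) (cdf (G x)) < 1}"

end

theory Submission
  imports Defs
begin

text \<open>
  The proof is Wald's. Write \<open>l z t\<close> for the log-likelihood of a single observation \<open>z\<close> at the
  parameter \<open>t\<close>. For a parameter \<open>t \<noteq> \<theta>0\<close> the mean of \<open>l z t - l z \<theta>0\<close> is negative; by continuity
  this persists for the supremum over a small neighbourhood of \<open>t\<close>, and by compactness finitely many
  such neighbourhoods cover the parameters outside a given ball around \<open>\<theta>0\<close>. Averaging over the
  sample, almost surely all those parameters eventually have smaller likelihood than \<open>\<theta>0\<close>, so no
  maximizer can lie there (\<open>wald_consistency\<close>).

  Passing from a negative mean to eventually negative sums needs only one half of the strong law of
  large numbers, and only under integrability (\<open>iid_sums_eventually_negative\<close>). It has a short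
  proof: let \<open>m n\<close> be the largest of zero and the first \<open>n\<close> partial sums and \<open>A\<close> the event that they are
  unbounded. \<open>A\<close> does not change when the sequence is shifted, so it is independent of the first
  term \<open>s\<close>, and comparing \<open>m (n + 1)\<close> with the shifted \<open>m n\<close> on \<open>A\<close> gives
  \<open>0 \<le> E (max (- m n) s ; A)\<close>, which tends to \<open>E s * P A\<close>. A negative mean forces \<open>P A = 0\<close>.

  What is special to censoring enters through the law of one observation. Conditional independence of
  \<open>Y\<close> and \<open>C\<close> given \<open>X\<close> yields the joint law of \<open>(X, Y, C)\<close> as an iterated integral
  (\<open>nn_integral_cond_law\<close>), and hence a formula for the law of \<open>(X, Z, \<delta>)\<close> with an uncensored part of
  density \<open>f\<close> and a censored part weighted by \<open>1 - F\<close> (\<open>nn_integral_P_obs\<close>). Four facts follow.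
  The likelihood ratio integrates to at most one, because its two parts integrate to \<open>F\<close> and \<open>1 - F\<close>
  (\<open>likelihood_ratio_le_1\<close>); with \<open>1 + u \<le> exp u\<close> the mean log ratio is at most zero, with equality
  only if the two log-likelihoods agree almost surely. That is ruled out by the condition on
  \<open>A_set\<close>, by which an uncensored observation with different densities at \<open>Y\<close> has positive
  probability (\<open>identifiable\<close>). The log-likelihood is almost surely continuous in the parameter, by Scheffe's
  lemma for \<open>F\<close> and because \<open>F = 1\<close> holds for all parameters or for none
  (\<open>AE_obs_loglik_continuous\<close>). Finally the log-likelihood at \<open>\<theta>0\<close> is integrable: its positive part
  by the bound on local suprema, its negative part because moreover \<open>L_fun\<close> is
  finite (\<open>integrable_loglik_true\<close>).
\<close>

section \<open>Sums of i.i.d. variables with negative mean\<close>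

text \<open>
  The largest of the partial sums of the first \<open>0, \<dots>, n\<close> terms. The recursion peels off the first
  term rather than the last one, since that is how the maximum behaves under the shift of a sequence.
\<close>

primrec max_partial_sum :: "nat \<Rightarrow> (nat \<Rightarrow> real) \<Rightarrow> real" where
  "max_partial_sum 0 \<omega> = 0"
| "max_partial_sum (Suc n) \<omega> = max 0 (\<omega> 0 + max_partial_sum n (\<lambda>i. \<omega> (Suc i)))"

lemma max_partial_sum_nonneg: "0 \<le> max_partial_sum n \<omega>"
  by (cases n) auto

lemma max_partial_sum_mono: "max_partial_sum n \<omega> \<le> max_partial_sum (Suc n) \<omega>"
proof (induction n arbitrary: \<omega>)
  case (Suc n)
  from Suc[of "\<lambda>i. \<omega> (Suc i)"] show ?case by (simp add: max_def)
qed simp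

lemma partial_sum_le_max_partial_sum: "(\<Sum>i<n. \<omega> i) \<le> max_partial_sum n \<omega>"
proof (induction n arbitrary: \<omega>)
  case (Suc n)
  from Suc[of "\<lambda>i. \<omega> (Suc i)"] show ?case
    by (simp add: sum.lessThan_Suc_shift del: sum.lessThan_Suc)
qed simp

lemma max_partial_sum_le_abs: "max_partial_sum n \<omega> \<le> (\<Sum>i<n. \<bar>\<omega> i\<bar>)"
proof (induction n arbitrary: \<omega>)
  case (Suc n)
  have "0 \<le> (\<Sum>i<n. \<bar>\<omega> (Suc i)\<bar>)" by (rule sum_nonneg) auto
  with Suc[of "\<lambda>i. \<omega> (Suc i)"] show ?case
    by (simp add: sum.lessThan_Suc_shift del: sum.lessThan_Suc)
qed simp

lemma measurable_max_partial_sum: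
  assumes "sets D = sets (borel :: real measure)"
  shows "max_partial_sum n \<in> borel_measurable (Pi\<^sub>M UNIV (\<lambda>_::nat. D))"
proof (induction n)
  case (Suc n)
  note [measurable] = Suc and [measurable_cong] = assms
  have [measurable]: "(\<lambda>\<omega>. (\<lambda>i. \<omega> (Suc i))) \<in> Pi\<^sub>M UNIV (\<lambda>_::nat. D) \<rightarrow>\<^sub>M Pi\<^sub>M UNIV (\<lambda>_::nat. D)"
    by (rule measurable_PiM_single') (auto simp: space_PiM)
  show ?case by simp
qed simp

text \<open>
  Maximal ergodic argument, carried out on the product space: prepending an independent term \<open>s\<close> to
  a sequence \<open>\<omega>\<close> preserves the product measure and leaves the event \<open>A\<close> of unbounded maxima
  unchanged, so that \<open>A\<close> is independent of \<open>s\<close>. On \<open>A\<close> the maxima grow without bound, which turns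
  the increment of their mean into the mean of \<open>s\<close> in the limit.
\<close>

lemma iid_max_partial_sum_bounded:
  fixes D :: "real measure"
  assumes D: "prob_space D" "sets D = sets borel" "integrable D (\<lambda>s. s)"
    and neg: "(\<integral>s. s \<partial>D) < 0"
  shows "AE \<omega> in Pi\<^sub>M UNIV (\<lambda>_::nat. D). \<exists>B::nat. \<forall>n. max_partial_sum n \<omega> \<le> B"
proof -
  interpret D: prob_space D by fact
  interpret product_prob_space "\<lambda>_. D" "UNIV :: nat set" by unfold_locales
  interpret sequence_space D by unfold_locales
  let ?m = max_partial_sum
  note [measurable_cong] = D(2)
  note [measurable] = measurable_max_partial_sum[OF D(2)]
  interpret SS: pair_prob_space D S by unfold_locales
  define A where "A = {\<omega> \<in> space S. \<forall>B::nat. \<exists>n. B < ?m n \<omega>}"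
  have A[measurable]: "A \<in> sets S" unfolding A_def by measurable
  have shift: "(\<lambda>(s, \<omega>). case_nat s \<omega>) \<in> D \<Otimes>\<^sub>M S \<rightarrow>\<^sub>M S"
    by measurable
  have coord: "integrable S (\<lambda>\<omega>. \<bar>\<omega> i\<bar>)" for i
  proof -
    have "distr S D (\<lambda>\<omega>. \<omega> i) = D" by (rule PiM_component) simp
    moreover have "integrable D (\<lambda>s. \<bar>s\<bar>)" using D(3) by simp
    ultimately show ?thesis
      using integrable_distr[of "\<lambda>\<omega>. \<omega> i" S D "\<lambda>s. \<bar>s\<bar>"] by simp
  qed
  have int_m: "integrable S (\<lambda>\<omega>. ?m n \<omega> * indicator A \<omega>)" for n
  proof (rule integrable_real_mult_indicator[OF A])
    show "integrable S (?m n)"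
      by (rule Bochner_Integration.integrable_bound[of _ "\<lambda>\<omega>. (\<Sum>i<n. \<bar>\<omega> i\<bar>)"])
        (use max_partial_sum_nonneg[of n] max_partial_sum_le_abs[of n] in \<open>auto intro!: coord Bochner_Integration.integrable_sum\<close>)
  qed
  have Ashift: "case_nat s \<omega> \<in> A \<longleftrightarrow> \<omega> \<in> A" if "s \<in> space D" "\<omega> \<in> space S" for s \<omega>
  proof -
    have sp: "case_nat s \<omega> \<in> space S"
      using that by (auto simp: space_PiM PiE_iff split: nat.split)
    have "(\<forall>B::nat. \<exists>n. B < ?m n (case_nat s \<omega>)) \<longleftrightarrow> (\<forall>B::nat. \<exists>n. B < ?m n \<omega>)"
    proof safe
      have "0 \<le> \<bar>s\<bar>" by simp
      then have ceil: "0 \<le> \<lceil>\<bar>s\<bar>\<rceil>" by linarith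
      fix B :: nat assume "\<forall>B::nat. \<exists>n. B < ?m n (case_nat s \<omega>)"
      then obtain n where n: "real (B + nat \<lceil>\<bar>s\<bar>\<rceil>) < ?m n (case_nat s \<omega>)" by blast
      then obtain k where "n = Suc k" by (cases n) (auto, linarith)
      with n ceil have "real B < ?m k \<omega>" by (simp add: max_def split: if_splits; linarith)
      then show "\<exists>n. B < ?m n \<omega>" by blast
    next
      fix B :: nat assume "\<forall>B::nat. \<exists>n. B < ?m n \<omega>"
      then obtain n where n: "real (B + nat \<lceil>\<bar>s\<bar>\<rceil>) < ?m n \<omega>" by blast
      then have "real B < ?m (Suc n) (case_nat s \<omega>)" by simp linarith
      then show "\<exists>n. B < ?m n (case_nat s \<omega>)" by blast
    qed
    with sp that show ?thesis by (simp add: A_def)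
  qed
  have iter: "distr (D \<Otimes>\<^sub>M S) S (\<lambda>z. case_nat (fst z) (snd z)) = S"
    using PiM_iter by (simp add: split_beta')
  have int_shift: "integrable (D \<Otimes>\<^sub>M S) (\<lambda>(s, \<omega>). ?m n (case_nat s \<omega>) * indicator A (case_nat s \<omega>))"
    and eq_shift: "(\<integral>(s, \<omega>). ?m n (case_nat s \<omega>) * indicator A (case_nat s \<omega>) \<partial>(D \<Otimes>\<^sub>M S))
      = (\<integral>\<omega>. ?m n \<omega> * indicator A \<omega> \<partial>S)" for n
    using integrable_distr[OF shift, of "\<lambda>\<omega>. ?m n \<omega> * indicator A \<omega>"] int_m[of n]
      integral_distr[OF shift, of "\<lambda>\<omega>. ?m n \<omega> * indicator A \<omega>"]
    by (simp_all add: iter split_beta')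
  have int_m2: "integrable (D \<Otimes>\<^sub>M S) (\<lambda>(s, \<omega>). ?m n \<omega> * indicator A \<omega>)"
    and eq_m2: "(\<integral>(s, \<omega>). ?m n \<omega> * indicator A \<omega> \<partial>(D \<Otimes>\<^sub>M S)) = (\<integral>\<omega>. ?m n \<omega> * indicator A \<omega> \<partial>S)" for n
  proof -
    have d: "distr (D \<Otimes>\<^sub>M S) S snd = S"
    proof (rule measure_eqI)
      fix B assume "B \<in> sets (distr (D \<Otimes>\<^sub>M S) S snd)"
      then have B: "B \<in> sets S" by simp
      then have "snd -` B \<inter> space (D \<Otimes>\<^sub>M S) = space D \<times> B"
        using sets.sets_into_space[OF B] by (auto simp: space_pair_measure)
      with B show "emeasure (distr (D \<Otimes>\<^sub>M S) S snd) B = emeasure S B"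
        by (simp add: emeasure_distr P.emeasure_pair_measure_Times D.emeasure_space_1)
    qed simp
    show "integrable (D \<Otimes>\<^sub>M S) (\<lambda>(s, \<omega>). ?m n \<omega> * indicator A \<omega>)"
      using integrable_distr[of snd "D \<Otimes>\<^sub>M S" S "\<lambda>\<omega>. ?m n \<omega> * indicator A \<omega>"] int_m[of n]
      by (simp add: d split_beta')
    show "(\<integral>(s, \<omega>). ?m n \<omega> * indicator A \<omega> \<partial>(D \<Otimes>\<^sub>M S)) = (\<integral>\<omega>. ?m n \<omega> * indicator A \<omega> \<partial>S)"
      using integral_distr[of snd "D \<Otimes>\<^sub>M S" S "\<lambda>\<omega>. ?m n \<omega> * indicator A \<omega>"]
      by (simp add: d split_beta')
  qed
  let ?g = "\<lambda>n (s, \<omega>). max (- ?m n \<omega>) s * indicator A \<omega> :: real"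
  \<comment> \<open>\<open>max 0 (s + m) - m = max (- m) s\<close> is the change of the maximum when \<open>s\<close> is prepended; its mean over \<open>A\<close> is the increment of the mean of the maxima, which are increasing in \<open>n\<close>\<close>
  have g_nonneg: "0 \<le> (\<integral>z. ?g n z \<partial>(D \<Otimes>\<^sub>M S))" for n
  proof -
    have "0 \<le> (\<integral>\<omega>. ?m (Suc n) \<omega> * indicator A \<omega> \<partial>S) - (\<integral>\<omega>. ?m n \<omega> * indicator A \<omega> \<partial>S)"
      using max_partial_sum_mono by (auto intro!: integral_mono int_m mult_right_mono simp del: max_partial_sum.simps)
    also have "\<dots> = (\<integral>z. (case z of (s, \<omega>) \<Rightarrow> ?m (Suc n) (case_nat s \<omega>) * indicator A (case_nat s \<omega>))
        - (case z of (s, \<omega>) \<Rightarrow> ?m n \<omega> * indicator A \<omega>) \<partial>(D \<Otimes>\<^sub>M S))"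
      using Bochner_Integration.integral_diff[OF int_shift[of "Suc n"] int_m2[of n]]
      by (simp add: eq_shift eq_m2 del: max_partial_sum.simps)
    also have "\<dots> = (\<integral>z. ?g n z \<partial>(D \<Otimes>\<^sub>M S))"
    proof (rule Bochner_Integration.integral_cong[OF refl])
      fix z assume "z \<in> space (D \<Otimes>\<^sub>M S)"
      then obtain s \<omega> where "z = (s, \<omega>)" "s \<in> space D" "\<omega> \<in> space S"
        by (auto simp: space_pair_measure)
      with Ashift show "(case z of (s, \<omega>) \<Rightarrow> ?m (Suc n) (case_nat s \<omega>) * indicator A (case_nat s \<omega>))
        - (case z of (s, \<omega>) \<Rightarrow> ?m n \<omega> * indicator A \<omega>) = ?g n z"
        by (auto simp: indicator_def max_def)
    qed
    finally show ?thesis .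
  qed
  have int_abs: "integrable (D \<Otimes>\<^sub>M S) (\<lambda>z. \<bar>fst z\<bar>)"
    using integrable_distr[of fst "D \<Otimes>\<^sub>M S" D abs] D(3) by (simp add: P.distr_pair_fst)
  \<comment> \<open>on \<open>A\<close> eventually \<open>- m \<le> s\<close>, and \<open>m \<ge> 0\<close> gives the dominating function \<open>\<bar>s\<bar>\<close>\<close>
  have "(\<lambda>n. \<integral>z. ?g n z \<partial>(D \<Otimes>\<^sub>M S)) \<longlonglongrightarrow> (\<integral>z. fst z * indicator A (snd z) \<partial>(D \<Otimes>\<^sub>M S))"
    and int_s: "integrable (D \<Otimes>\<^sub>M S) (\<lambda>z. fst z * indicator A (snd z) :: real)"
  proof -
    have lim: "(\<lambda>n. ?g n z) \<longlonglongrightarrow> fst z * indicator A (snd z)" for z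
    proof (cases "snd z \<in> A")
      case True
      then obtain n where "real (nat \<lceil>\<bar>fst z\<bar>\<rceil>) < ?m n (snd z)" unfolding A_def by blast
      then have n: "- ?m n (snd z) \<le> fst z" by linarith
      have "- ?m k (snd z) \<le> fst z" if "n \<le> k" for k
        using lift_Suc_mono_le[of "\<lambda>n. ?m n (snd z)", OF max_partial_sum_mono that] n by simp
      then have "eventually (\<lambda>k. ?g k z = fst z * indicator A (snd z)) sequentially"
        unfolding eventually_sequentially by (intro exI[of _ n]) (auto simp: split_beta max_def)
      then show ?thesis by (rule tendsto_eventually)
    qed (simp add: split_beta)
    have bound: "norm (?g n z) \<le> \<bar>fst z\<bar>" for n z
      using max_partial_sum_nonneg[of n "snd z"] by (auto simp: split_beta indicator_def max_def)
    have meas: "(\<lambda>z. fst z * indicator A (snd z)) \<in> borel_measurable (D \<Otimes>\<^sub>M S)"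
      "\<And>n. ?g n \<in> borel_measurable (D \<Otimes>\<^sub>M S)"
      by measurable
    show "(\<lambda>n. \<integral>z. ?g n z \<partial>(D \<Otimes>\<^sub>M S)) \<longlonglongrightarrow> (\<integral>z. fst z * indicator A (snd z) \<partial>(D \<Otimes>\<^sub>M S))"
      by (rule integral_dominated_convergence[where s = ?g, OF meas int_abs AE_I2[OF lim] AE_I2[OF bound]])
    show "integrable (D \<Otimes>\<^sub>M S) (\<lambda>z. fst z * indicator A (snd z) :: real)"
      by (rule integrable_dominated_convergence[where s = ?g, OF meas int_abs AE_I2[OF lim] AE_I2[OF bound]])
  qed
  from LIMSEQ_le_const[OF this(1)] g_nonneg
  have "0 \<le> (\<integral>z. fst z * indicator A (snd z) \<partial>(D \<Otimes>\<^sub>M S))" by auto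
  also have "\<dots> = (\<integral>s. s \<partial>D) * measure S A"
    using SS.integral_fst'[OF int_s] by (simp add: mult.commute)
  finally have "measure S A \<le> 0"
    using neg by (simp add: zero_le_mult_iff)
  then have "A \<in> null_sets S" by (simp add: null_setsI P.emeasure_eq_measure measure_le_0_iff)
  from AE_not_in[OF this] AE_space show ?thesis
    by eventually_elim (auto simp: A_def not_less)
qed

lemma (in prob_space) iid_sums_bounded_above:
  fixes W :: "nat \<Rightarrow> 'a \<Rightarrow> real"
  assumes indep: "indep_vars (\<lambda>_. borel) W UNIV"
    and law: "\<And>i. distr M borel (W i) = D"
    and int: "integrable D (\<lambda>s. s)" and neg: "(\<integral>s. s \<partial>D) < 0"
  shows "AE \<omega> in M. \<exists>B. \<forall>n. (\<Sum>i<n. W i \<omega>) \<le> B"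
proof -
  have rv: "\<And>i. W i \<in> borel_measurable M"
    using indep unfolding indep_vars_def by auto
  have D: "prob_space D" "sets D = sets borel"
    using prob_space_distr[OF rv] by (auto simp flip: law[of 0])
  have eq: "distr M (Pi\<^sub>M UNIV (\<lambda>_. borel)) (\<lambda>\<omega>. \<lambda>i\<in>UNIV. W i \<omega>) = Pi\<^sub>M UNIV (\<lambda>_. D)"
    using indep by (subst (asm) indep_vars_iff_distr_eq_PiM) (auto simp: rv law)
  have "AE \<omega> in distr M (Pi\<^sub>M UNIV (\<lambda>_. borel)) (\<lambda>\<omega>. \<lambda>i\<in>UNIV. W i \<omega>).
      \<exists>B::nat. \<forall>n. max_partial_sum n \<omega> \<le> B"
    unfolding eq by (rule iid_max_partial_sum_bounded[OF D int neg])
  then have "AE \<omega> in M. \<exists>B::nat. \<forall>n. max_partial_sum n (\<lambda>i\<in>UNIV. W i \<omega>) \<le> B"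
    by (rule AE_distrD[rotated]) (use rv in measurable)
  then show ?thesis
  proof eventually_elim
    case (elim \<omega>)
    then obtain B :: nat where "\<forall>n. max_partial_sum n (\<lambda>i\<in>UNIV. W i \<omega>) \<le> B" ..
    then have "(\<Sum>i<n. W i \<omega>) \<le> B" for n
      using partial_sum_le_max_partial_sum[of "\<lambda>i\<in>UNIV. W i \<omega>" n] by (auto intro: order_trans)
    then show ?case by blast
  qed
qed

text \<open>
  Boundedness of the sums improves to negativity by spending half of the (negative) mean: the sums of
  \<open>g + \<epsilon>\<close> are still bounded above, so those of \<open>g\<close> fall below \<open>B - n * \<epsilon>\<close>.
\<close>

lemma (in prob_space) iid_sums_eventually_negative:
  fixes W :: "nat \<Rightarrow> 'a \<Rightarrow> 'b" and g :: "'b \<Rightarrow> real"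
  assumes indep: "indep_vars (\<lambda>_. N) W UNIV"
    and law: "\<And>i. distr M N (W i) = P"
    and int: "integrable P g" and neg: "(\<integral>z. g z \<partial>P) < 0"
  shows "AE \<omega> in M. \<forall>\<^sub>F n in sequentially. (\<Sum>i<n. g (W i \<omega>)) < 0"
proof -
  define \<epsilon> where "\<epsilon> = - (\<integral>z. g z \<partial>P) / 2"
  have \<epsilon>: "0 < \<epsilon>" using neg by (simp add: \<epsilon>_def)
  have rv: "\<And>i. W i \<in> M \<rightarrow>\<^sub>M N"
    using indep unfolding indep_vars_def by auto
  interpret P: prob_space P using prob_space_distr[OF rv] by (simp flip: law[of 0])
  have sets: "sets P = sets N" by (simp flip: law[of 0])
  have g: "g \<in> borel_measurable N" using borel_measurable_integrable[OF int] sets measurable_cong_sets by blast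
  let ?g = "\<lambda>z. g z + \<epsilon>"
  have g': "?g \<in> borel_measurable N" using g by measurable
  have "AE \<omega> in M. \<exists>B. \<forall>n. (\<Sum>i<n. ?g (W i \<omega>)) \<le> B"
  proof (rule iid_sums_bounded_above)
    show "indep_vars (\<lambda>_. borel) (\<lambda>i \<omega>. ?g (W i \<omega>)) UNIV"
      by (rule indep_vars_compose2[OF indep]) (rule g')
    show "distr M borel (\<lambda>\<omega>. ?g (W i \<omega>)) = distr P borel ?g" for i
      using distr_distr[OF g' rv[of i]] by (simp add: law comp_def)
    have g'': "?g \<in> borel_measurable P" using int by measurable
    show "integrable (distr P borel ?g) (\<lambda>s. s)"
      using int by (subst integrable_distr_eq[OF g'']) auto
    show "(\<integral>s. s \<partial>distr P borel ?g) < 0"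
      using int neg by (subst integral_distr[OF g'']) (auto simp: \<epsilon>_def P.prob_space)
  qed
  then show ?thesis
  proof eventually_elim
    case (elim \<omega>)
    then obtain B where B: "\<And>n. (\<Sum>i<n. g (W i \<omega>)) + n * \<epsilon> \<le> B"
      by (auto simp: sum.distrib)
    have "\<forall>\<^sub>F n in sequentially. B / \<epsilon> < real n"
      by (rule eventually_gt_at_top[THEN eventually_compose_filterlim]) (rule filterlim_real_sequentially)
    then show ?case
    proof eventually_elim
      case (elim n)
      then have "B < n * \<epsilon>" using \<epsilon> by (simp add: pos_divide_less_eq)
      with B[of n] show ?case by linarith
    qed
  qed
qed

section \<open>Wald's consistency argument\<close>

lemma SUP_dense_subset:
  fixes g :: "'t::metric_space \<Rightarrow> real"
  assumes cont: "continuous_on A g" and "D \<subseteq> A" "A \<subseteq> closure D"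
  shows "(SUP t\<in>A. ereal (g t)) = (SUP t\<in>D. ereal (g t))"
proof (rule antisym)
  show "(SUP t\<in>A. ereal (g t)) \<le> (SUP t\<in>D. ereal (g t))"
  proof (rule SUP_least)
    fix t assume t: "t \<in> A"
    with assms have "t \<in> closure D" by auto
    then obtain s where s: "\<And>n. s n \<in> D" "s \<longlonglongrightarrow> t"
      unfolding closure_sequential by auto
    have "(\<lambda>n. g (s n)) \<longlonglongrightarrow> g t"
      using cont t s \<open>D \<subseteq> A\<close> by (auto simp: continuous_on_sequentially o_def)
    then have "(\<lambda>n. ereal (g (s n))) \<longlonglongrightarrow> ereal (g t)" by simp
    then show "ereal (g t) \<le> (SUP t\<in>D. ereal (g t))"
      by (rule LIMSEQ_le_const2) (use s in \<open>auto intro!: SUP_upper\<close>)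
  qed
qed (use \<open>D \<subseteq> A\<close> in \<open>auto intro: SUP_subset_mono\<close>)

text \<open>
  A supremum over an uncountable set of parameters need not be measurable. Where the function is
  continuous in the parameter it agrees with a measurable function, the supremum over a countable
  dense subset, which is the form in which suprema are integrated below.
\<close>

lemma measurable_SUP_continuous:
  fixes l :: "'z \<Rightarrow> 't::{metric_space, second_countable_topology} \<Rightarrow> real"
  assumes meas: "\<And>t. t \<in> A \<Longrightarrow> (\<lambda>z. l z t) \<in> borel_measurable N"
  obtains S :: "'z \<Rightarrow> ereal" where "S \<in> borel_measurable N"
    and "\<And>z. continuous_on A (l z) \<Longrightarrow> (SUP t\<in>A. ereal (l z t)) = S z"
proof -
  obtain D where D: "countable D" "D \<subseteq> A" "A \<subseteq> closure D" by (rule separable)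
  show thesis
  proof
    show "(\<lambda>z. SUP t\<in>D. ereal (l z t)) \<in> borel_measurable N"
      using D meas by (intro borel_measurable_SUP) auto
    show "(SUP t\<in>A. ereal (l z t)) = (SUP t\<in>D. ereal (l z t))" if "continuous_on A (l z)" for z
      by (rule SUP_dense_subset[OF that D(2,3)])
  qed
qed

text \<open>
  The equality case of the Kullback-Leibler inequality: \<open>exp D - 1 - D\<close> is nonnegative, vanishes only
  at \<open>D = 0\<close>, and has mean at most zero.
\<close>

lemma (in prob_space) log_ratio_eq_0_if_nonneg_mean:
  fixes D :: "'a \<Rightarrow> real"
  assumes int: "integrable M D" and exp: "(\<integral>\<^sup>+ z. ennreal (exp (D z)) \<partial>M) \<le> 1"
    and nonneg: "0 \<le> (\<integral>z. D z \<partial>M)"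
  shows "AE z in M. D z = 0"
proof -
  have [measurable]: "D \<in> borel_measurable M" using int by simp
  have int_exp: "integrable M (\<lambda>z. exp (D z))"
    using exp by (intro integrableI_bounded) (auto intro: le_less_trans)
  have "(\<integral>z. exp (D z) \<partial>M) \<le> 1"
    using exp by (simp add: nn_integral_eq_integral[OF int_exp])
  then have "(\<integral>z. exp (D z) - 1 - D z \<partial>M) \<le> 0"
    using nonneg by (simp add: int_exp int prob_space)
  moreover have pos: "0 \<le> exp (D z) - 1 - D z" for z
    using exp_ge_add_one_self[of "D z"] by linarith
  ultimately have "(\<integral>z. exp (D z) - 1 - D z \<partial>M) = 0"
    by (intro antisym) (auto intro!: integral_nonneg_AE)
  then have "AE z in M. exp (D z) - 1 - D z = 0"
    by (subst (asm) integral_nonneg_eq_0_iff_AE) (use pos int int_exp in auto)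
  then show ?thesis
  proof eventually_elim
    case (elim z)
    show ?case
    proof (rule ccontr)
      assume "D z \<noteq> 0"
      with ln_eq_minus_one[of "exp (D z)"] elim show False by simp
    qed
  qed
qed

text \<open>
  Used with suprema over shrinking neighbourhoods, whose limit may a priori have mean \<open>- \<infinity>\<close>; the
  lower bound on the means excludes this.
\<close>

lemma (in prob_space) decreasing_limit_integrable:
  fixes T :: "nat \<Rightarrow> 'a \<Rightarrow> real"
  assumes int: "\<And>k. integrable M (T k)" and dec: "AE z in M. decseq (\<lambda>k. T k z)"
    and lim: "AE z in M. (\<lambda>k. T k z) \<longlonglongrightarrow> u z" and u: "u \<in> borel_measurable M"
    and bound: "\<And>k. b \<le> (\<integral>z. T k z \<partial>M)"
  shows "integrable M u" and "b \<le> (\<integral>z. u z \<partial>M)"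
proof -
  have "decseq (\<lambda>k. \<integral>z. T k z \<partial>M)"
    unfolding decseq_def using int dec by (auto intro!: integral_mono_AE simp: decseq_def)
  then obtain L where L: "(\<lambda>k. \<integral>z. T k z \<partial>M) \<longlonglongrightarrow> L"
    by (rule decseq_convergent[of _ b]) (use bound in auto)
  have neg: "(\<lambda>k. \<integral>z. - T k z \<partial>M) \<longlonglongrightarrow> - L"
    using tendsto_minus[OF L] int by simp
  have mono: "AE z in M. mono (\<lambda>k. - T k z)"
    using dec by eventually_elim (auto simp: decseq_def mono_def)
  have lim': "AE z in M. (\<lambda>k. - T k z) \<longlonglongrightarrow> - u z"
    using lim by eventually_elim (rule tendsto_minus)
  have "integrable M (\<lambda>z. - u z)" "(\<integral>z. - u z \<partial>M) = - L"
    using integrable_monotone_convergence[OF _ mono lim' neg] integral_monotone_convergence[OF _ mono lim' neg] int u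
    by auto
  then show "integrable M u" "b \<le> (\<integral>z. u z \<partial>M)"
    using LIMSEQ_le_const[OF L] bound by auto
qed

text \<open>
  The function \<open>h\<close> is the supremum of \<open>l\<close> over the ball of radius \<open>1 / (k + 1)\<close> around \<open>t\<close> within \<open>V\<close>,
  truncated from below at \<open>- k\<close>, minus \<open>l\<close> at \<open>t0\<close>. The truncation makes it integrable. If its mean
  were nonnegative for every \<open>k\<close>, then letting \<open>k\<close> tend to infinity would make the mean of
  \<open>l z t - l z t0\<close> nonnegative, and the two log-likelihoods would agree almost surely.
\<close>

lemma (in prob_space) wald_local_bound:
  fixes l :: "'a \<Rightarrow> 't::{metric_space, second_countable_topology} \<Rightarrow> real"
  assumes meas: "\<And>t. t \<in> \<Theta> \<Longrightarrow> (\<lambda>z. l z t) \<in> borel_measurable M"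
    and cont: "AE z in M. continuous_on \<Theta> (l z)"
    and t0: "integrable M (\<lambda>z. l z t0)"
    and t: "t \<in> \<Theta>"
    and ratio: "(\<integral>\<^sup>+ z. ennreal (exp (l z t - l z t0)) \<partial>M) \<le> 1"
    and ident: "\<not> (AE z in M. l z t = l z t0)"
    and V: "openin (top_of_set \<Theta>) V" "t \<in> V"
    and sup: "(\<integral>\<^sup>+ z. e2ennreal (SUP s\<in>V. ereal (l z s)) \<partial>M) < \<infinity>"
  shows "\<exists>U h. open U \<and> t \<in> U \<and> integrable M h \<and> (\<integral>z. h z \<partial>M) < 0
      \<and> (AE z in M. \<forall>s\<in>U \<inter> \<Theta>. l z s - l z t0 \<le> h z)"
proof -
  obtain O' where O': "open O'" "V = \<Theta> \<inter> O'" using V(1) by (auto simp: openin_open)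
  define V' where "V' k = V \<inter> ball t (1 / Suc k)" for k :: nat
  have V'_sub: "V' k \<subseteq> V" "V \<subseteq> \<Theta>" for k using O' by (auto simp: V'_def)
  have t_V': "t \<in> V' k" for k using V(2) by (simp add: V'_def)
  have "\<exists>S. S \<in> borel_measurable M \<and> (\<forall>z. continuous_on (V' k) (l z) \<longrightarrow> (SUP s\<in>V' k. ereal (l z s)) = S z)" for k
    by (rule measurable_SUP_continuous[of "V' k" l M]) (use V'_sub meas in auto)
  then obtain S where S[measurable]: "\<And>k. S k \<in> borel_measurable M"
    and S_eq: "\<And>k z. continuous_on (V' k) (l z) \<Longrightarrow> (SUP s\<in>V' k. ereal (l z s)) = S k z"
    by metis
  obtain SV where SV[measurable]: "SV \<in> borel_measurable M"
    and SV_eq: "\<And>z. continuous_on V (l z) \<Longrightarrow> (SUP s\<in>V. ereal (l z s)) = SV z"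
    by (rule measurable_SUP_continuous[of V l M]) (use V'_sub meas in auto)
  have contV: "AE z in M. continuous_on V (l z) \<and> (\<forall>k. continuous_on (V' k) (l z))"
    using cont by eventually_elim (meson V'_sub continuous_on_subset)
  have "(\<integral>\<^sup>+ z. e2ennreal (SV z) \<partial>M) = (\<integral>\<^sup>+ z. e2ennreal (SUP s\<in>V. ereal (l z s)) \<partial>M)"
    by (rule nn_integral_cong_AE) (use contV in eventually_elim, simp add: SV_eq)
  with sup have SV_fin: "(\<integral>\<^sup>+ z. e2ennreal (SV z) \<partial>M) < \<infinity>" by simp
  have SV_less: "AE z in M. SV z < \<infinity>"
  proof -
    have "AE z in M. e2ennreal (SV z) \<noteq> \<infinity>"
      using SV_fin by (intro nn_integral_PInf_AE) auto
    then show ?thesis by eventually_elim (auto simp: top_ereal_def)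
  qed
  define T where "T k z = max (real_of_ereal (S k z)) (- real k)" for k z
  have [measurable]: "T k \<in> borel_measurable M" for k unfolding T_def by measurable
  \<comment> \<open>the finite suprema in terms of real numbers: upper bound, least upper bound, and the dominating positive part\<close>
  have good: "AE z in M. continuous_on \<Theta> (l z) \<and> (\<forall>k. \<forall>s\<in>V' k. l z s \<le> real_of_ereal (S k z))
      \<and> (\<forall>k b. (\<forall>s\<in>V' k. l z s \<le> b) \<longrightarrow> real_of_ereal (S k z) \<le> b)
      \<and> (\<forall>k. ennreal (real_of_ereal (S k z)) \<le> e2ennreal (SV z))"
    using cont contV SV_less
  proof eventually_elim
    case (elim z)
    have eq: "S k z = (SUP s\<in>V' k. ereal (l z s))" "SV z = (SUP s\<in>V. ereal (l z s))" for k
      using elim S_eq SV_eq by auto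
    have le: "S k z \<le> SV z" for k unfolding eq by (rule SUP_subset_mono[OF V'_sub(1)]) simp
    have ge: "ereal (l z s) \<le> S k z" if "s \<in> V' k" for k s unfolding eq using that by (rule SUP_upper)
    have fin: "\<bar>S k z\<bar> \<noteq> \<infinity>" for k
      using le[of k] ge[OF t_V'[of k]] elim by auto
    then have real: "ereal (real_of_ereal (S k z)) = S k z" for k by (simp add: ereal_real)
    have "l z s \<le> real_of_ereal (S k z)" if "s \<in> V' k" for k s
      using ge[OF that] by (subst ereal_less_eq(3)[symmetric]) (simp add: real)
    moreover have "real_of_ereal (S k z) \<le> b" if "\<forall>s\<in>V' k. l z s \<le> b" for k b
    proof -
      have "S k z \<le> ereal b" unfolding eq using that by (auto intro: SUP_least)
      then show ?thesis by (subst ereal_less_eq(3)[symmetric]) (simp add: real)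
    qed
    moreover have "ennreal (real_of_ereal (S k z)) \<le> e2ennreal (SV z)" for k
      using e2ennreal_mono[OF le[of k]] by (subst (asm) real[symmetric]) (simp add: ennreal.rep_eq e2ennreal_ereal)
    ultimately show ?case using elim by blast
  qed
  have T_int: "integrable M (T k)" for k
  proof (rule integrableI_bounded)
    have "(\<integral>\<^sup>+ z. ennreal (norm (T k z)) \<partial>M) \<le> (\<integral>\<^sup>+ z. e2ennreal (SV z) + ennreal (real k) \<partial>M)"
    proof (rule nn_integral_mono_AE)
      show "AE z in M. ennreal (norm (T k z)) \<le> e2ennreal (SV z) + ennreal (real k)"
        using good
      proof eventually_elim
        case (elim z)
        have "norm (T k z) \<le> max 0 (real_of_ereal (S k z)) + real k" by (auto simp: T_def)
        then have "ennreal (norm (T k z)) \<le> ennreal (max 0 (real_of_ereal (S k z)) + real k)"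
          by (rule ennreal_leI)
        also have "\<dots> = ennreal (real_of_ereal (S k z)) + ennreal (real k)"
          by (cases "0 \<le> real_of_ereal (S k z)") (simp_all del: real_of_ereal_le_0 add: ennreal_neg[of "real_of_ereal (S k z)"] flip: ennreal_plus)
        also have "\<dots> \<le> e2ennreal (SV z) + ennreal (real k)"
          using elim by (intro add_right_mono) auto
        finally show ?case .
      qed
    qed
    also have "\<dots> = (\<integral>\<^sup>+ z. e2ennreal (SV z) \<partial>M) + ennreal (real k)"
      by (subst nn_integral_add) (auto simp: emeasure_space_1)
    also have "\<dots> < \<infinity>" using SV_fin by (simp add: less_top)
    finally show "(\<integral>\<^sup>+ z. ennreal (norm (T k z)) \<partial>M) < \<infinity>" .
  qed measurable
  have "\<exists>k. (\<integral>z. T k z \<partial>M) < (\<integral>z. l z t0 \<partial>M)"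
  proof (rule ccontr)
    assume "\<not> ?thesis"
    then have bound: "\<And>k. (\<integral>z. l z t0 \<partial>M) \<le> (\<integral>z. T k z \<partial>M)" by (auto simp: not_less)
    have dec: "AE z in M. decseq (\<lambda>k. T k z)"
      using good
    proof eventually_elim
      case (elim z)
      show ?case
      proof (rule decseq_SucI)
        fix k
        have "V' (Suc k) \<subseteq> V' k"
          unfolding V'_def by (intro Int_mono subset_ball) (auto simp: field_simps)
        with elim have "real_of_ereal (S (Suc k) z) \<le> real_of_ereal (S k z)" by blast
        then show "T (Suc k) z \<le> T k z" by (auto simp: T_def)
      qed
    qed
    \<comment> \<open>continuity at \<open>t\<close> squeezes the suprema, and the truncation is inactive once \<open>- k\<close> is below \<open>l z t\<close>\<close>
    have lim: "AE z in M. (\<lambda>k. T k z) \<longlonglongrightarrow> l z t"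
      using good
    proof eventually_elim
      case (elim z)
      show ?case
      proof (rule LIMSEQ_I)
        fix e :: real assume "0 < e"
        with elim t obtain r where r: "r > 0" "\<And>s. s \<in> \<Theta> \<Longrightarrow> dist s t < r \<Longrightarrow> dist (l z s) (l z t) < e / 2"
          unfolding continuous_on_iff by (metis half_gt_zero)
        obtain n1 where n1: "1 / Suc n1 < r" using r(1) nat_approx_posE by blast
        obtain n2 :: nat where n2: "- l z t \<le> n2" using real_arch_simple by blast
        have "norm (T k z - l z t) < e" if k: "k \<ge> max n1 n2" for k
        proof -
          have "1 / Suc k \<le> 1 / Suc n1" using k by (intro divide_left_mono) auto
          have "l z s \<le> l z t + e / 2" if s: "s \<in> V' k" for s
          proof -
            have "s \<in> \<Theta>" using s V'_sub by blast
            moreover have "dist s t < r"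
              using s n1 \<open>1 / Suc k \<le> 1 / Suc n1\<close> by (simp add: V'_def dist_commute)
            ultimately show ?thesis using r(2)[of s] by (simp add: dist_real_def abs_if split: if_splits)
          qed
          then have "real_of_ereal (S k z) \<le> l z t + e / 2" using elim by blast
          moreover have "l z t \<le> real_of_ereal (S k z)" using elim t_V' by blast
          moreover have "- real k \<le> l z t" using n2 k by auto
          ultimately show ?thesis using \<open>0 < e\<close> by (auto simp: T_def)
        qed
        then show "\<exists>no. \<forall>k\<ge>no. norm (T k z - l z t) < e" by blast
      qed
    qed
    note u = decreasing_limit_integrable[OF T_int dec lim meas[OF t] bound]
    have "AE z in M. l z t - l z t0 = 0"
      by (rule log_ratio_eq_0_if_nonneg_mean) (use u t0 ratio in auto)
    with ident show False by simp
  qed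
  then obtain k where k: "(\<integral>z. T k z \<partial>M) < (\<integral>z. l z t0 \<partial>M)" ..
  show ?thesis
  proof (intro exI conjI)
    show "open (O' \<inter> ball t (1 / Suc k))" using O' by auto
    show "t \<in> O' \<inter> ball t (1 / Suc k)" using O' V by auto
    show "integrable M (\<lambda>z. T k z - l z t0)" using T_int t0 by auto
    show "(\<integral>z. T k z - l z t0 \<partial>M) < 0" using T_int t0 k by auto
    show "AE z in M. \<forall>s\<in>O' \<inter> ball t (1 / Suc k) \<inter> \<Theta>. l z s - l z t0 \<le> T k z - l z t0"
      using good
    proof eventually_elim
      case (elim z)
      then have "\<forall>s\<in>V' k. l z s \<le> T k z" by (auto simp: T_def intro: max.coboundedI1)
      then show ?case by (auto simp: V'_def O')
    qed
  qed
qed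

text \<open>
  Each parameter other than \<open>t0\<close> has a neighbourhood on which the log-likelihood of the sample is
  eventually smaller than at \<open>t0\<close>: it is bounded there by a sum of i.i.d. terms with negative mean.
  Compactness makes this uniform outside a ball around \<open>t0\<close>, and countably many radii suffice.
\<close>

theorem (in prob_space) wald_consistency:
  fixes l :: "'z \<Rightarrow> 't::{metric_space, second_countable_topology} \<Rightarrow> real"
    and W :: "nat \<Rightarrow> 'a \<Rightarrow> 'z"
  assumes indep: "indep_vars (\<lambda>_. N) W UNIV" and law: "\<And>i. distr M N (W i) = P"
    and meas: "\<And>t. t \<in> \<Theta> \<Longrightarrow> (\<lambda>z. l z t) \<in> borel_measurable P"
    and cont: "AE z in P. continuous_on \<Theta> (l z)"
    and comp: "compact \<Theta>"
    and t0: "t0 \<in> \<Theta>" "integrable P (\<lambda>z. l z t0)"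
    and ratio: "\<And>t. t \<in> \<Theta> \<Longrightarrow> (\<integral>\<^sup>+ z. ennreal (exp (l z t - l z t0)) \<partial>P) \<le> 1"
    and ident: "\<And>t. t \<in> \<Theta> - {t0} \<Longrightarrow> \<not> (AE z in P. l z t = l z t0)"
    and sup: "\<And>t. t \<in> \<Theta> \<Longrightarrow> \<exists>V. openin (top_of_set \<Theta>) V \<and> t \<in> V
        \<and> (\<integral>\<^sup>+ z. e2ennreal (SUP s\<in>V. ereal (l z s)) \<partial>P) < \<infinity>"
    and maximizer: "AE w in M. \<forall>n\<ge>1. is_arg_max (\<lambda>t. \<Sum>i<n. l (W i w) t) (\<lambda>t. t \<in> \<Theta>) (that n w)"
  shows "AE w in M. (\<lambda>n. that n w) \<longlonglongrightarrow> t0"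
proof -
  have rv: "\<And>i. W i \<in> M \<rightarrow>\<^sub>M N" using indep unfolding indep_vars_def by auto
  interpret P: prob_space P using prob_space_distr[OF rv] by (simp flip: law[of 0])
  let ?L = "\<lambda>n w t. \<Sum>i<n. l (W i w) t"
  have local: "\<exists>U. open U \<and> t \<in> U \<and> (AE w in M. \<forall>\<^sub>F n in sequentially. \<forall>s\<in>U \<inter> \<Theta>. ?L n w s < ?L n w t0)"
    if t: "t \<in> \<Theta> - {t0}" for t
  proof -
    from sup[of t] t obtain V where V: "openin (top_of_set \<Theta>) V" "t \<in> V"
        "(\<integral>\<^sup>+ z. e2ennreal (SUP s\<in>V. ereal (l z s)) \<partial>P) < \<infinity>" by auto
    have tt: "t \<in> \<Theta>" using t by simp
    from P.wald_local_bound[OF meas cont t0(2) tt ratio[OF tt] ident[OF t] V] obtain U h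
      where U: "open U" "t \<in> U" and h: "integrable P h" "(\<integral>z. h z \<partial>P) < 0"
        and le: "AE z in P. \<forall>s\<in>U \<inter> \<Theta>. l z s - l z t0 \<le> h z" by blast
    have "AE w in M. \<forall>i. \<forall>s\<in>U \<inter> \<Theta>. l (W i w) s - l (W i w) t0 \<le> h (W i w)"
      unfolding AE_all_countable
    proof
      fix i
      show "AE w in M. \<forall>s\<in>U \<inter> \<Theta>. l (W i w) s - l (W i w) t0 \<le> h (W i w)"
        by (rule AE_distrD[OF rv[of i]]) (simp only: law le)
    qed
    with iid_sums_eventually_negative[OF indep law h]
    have "AE w in M. \<forall>\<^sub>F n in sequentially. \<forall>s\<in>U \<inter> \<Theta>. ?L n w s < ?L n w t0"
    proof eventually_elim
      case (elim w)
      from elim(1) show ?case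
      proof eventually_elim
        case neg: (elim n)
        show ?case
        proof
          fix s assume "s \<in> U \<inter> \<Theta>"
          with elim(2) have "(\<Sum>i<n. l (W i w) s - l (W i w) t0) \<le> (\<Sum>i<n. h (W i w))"
            by (intro sum_mono) auto
          with neg show "?L n w s < ?L n w t0" by (simp add: sum_subtractf)
        qed
      qed
    qed
    with U show ?thesis by blast
  qed
  have far: "AE w in M. \<forall>\<^sub>F n in sequentially. \<forall>s\<in>\<Theta> - ball t0 e. ?L n w s < ?L n w t0" if e: "0 < e" for e
  proof -
    have "\<forall>t\<in>\<Theta> - {t0}. \<exists>U. open U \<and> t \<in> U
        \<and> (AE w in M. \<forall>\<^sub>F n in sequentially. \<forall>s\<in>U \<inter> \<Theta>. ?L n w s < ?L n w t0)"
      using local by blast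
    from bchoice[OF this] obtain U where U: "\<And>t. t \<in> \<Theta> - {t0} \<Longrightarrow> open (U t) \<and> t \<in> U t
        \<and> (AE w in M. \<forall>\<^sub>F n in sequentially. \<forall>s\<in>U t \<inter> \<Theta>. ?L n w s < ?L n w t0)" by blast
    have sub: "\<Theta> - ball t0 e \<subseteq> \<Theta> - {t0}" using e by auto
    have "compact (\<Theta> - ball t0 e)" using comp by (intro compact_diff) auto
    moreover have "\<And>t. t \<in> \<Theta> - ball t0 e \<Longrightarrow> open (U t)" using sub U by blast
    moreover have "\<Theta> - ball t0 e \<subseteq> (\<Union>t\<in>\<Theta> - ball t0 e. U t)" using sub U by blast
    ultimately obtain K where K: "K \<subseteq> \<Theta> - ball t0 e" "finite K" "\<Theta> - ball t0 e \<subseteq> (\<Union>t\<in>K. U t)"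
      by (rule compactE_image)
    have "AE w in M. \<forall>t\<in>K. \<forall>\<^sub>F n in sequentially. \<forall>s\<in>U t \<inter> \<Theta>. ?L n w s < ?L n w t0"
    proof (rule AE_finite_allI[OF K(2)])
      fix t assume "t \<in> K"
      then show "AE w in M. \<forall>\<^sub>F n in sequentially. \<forall>s\<in>U t \<inter> \<Theta>. ?L n w s < ?L n w t0"
        using K(1) sub U by blast
    qed
    then show ?thesis
    proof eventually_elim
      case (elim w)
      then have "\<forall>\<^sub>F n in sequentially. \<forall>t\<in>K. \<forall>s\<in>U t \<inter> \<Theta>. ?L n w s < ?L n w t0"
        using K(2) by (simp add: eventually_ball_finite)
      then show ?case by eventually_elim (use K(3) in blast)
    qed
  qed
  have "AE w in M. \<forall>k. \<forall>\<^sub>F n in sequentially. \<forall>s\<in>\<Theta> - ball t0 (1 / Suc k). ?L n w s < ?L n w t0"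
    unfolding AE_all_countable by (intro allI far) simp
  with maximizer show ?thesis
  proof eventually_elim
    case (elim w)
    show ?case
    proof (rule tendstoI)
      fix e :: real assume "0 < e"
      then obtain k where k: "1 / Suc k < e" using nat_approx_posE by blast
      have "\<forall>\<^sub>F n in sequentially. \<forall>s\<in>\<Theta> - ball t0 (1 / Suc k). ?L n w s < ?L n w t0"
        using elim by blast
      with eventually_ge_at_top[of 1] show "\<forall>\<^sub>F n in sequentially. dist (that n w) t0 < e"
      proof eventually_elim
        case n: (elim n)
        then have "is_arg_max (?L n w) (\<lambda>t. t \<in> \<Theta>) (that n w)" using elim by blast
        then have "that n w \<in> \<Theta>" "\<not> ?L n w (that n w) < ?L n w t0"
          using t0(1) by (auto simp: is_arg_max_def)
        with n have "that n w \<in> ball t0 (1 / Suc k)" by blast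
        with k show ?case by (simp add: dist_commute)
      qed
    qed
  qed
qed

section \<open>Extended integrals and conditional laws\<close>

text \<open>
  These two bounds let iterated extended integrals be estimated from inside out without knowing that
  the inner integrals exist: a nonexistent integral has the value \<open>\<infinity>\<close>, but then the integral of the
  positive part is infinite as well and both bounds are trivial.
\<close>

lemma e2ennreal_ext_integral_le: "e2ennreal (ext_integral M u) \<le> (\<integral>\<^sup>+ x. e2ennreal (u x) \<partial>M)"
proof -
  have "e2ennreal (enn2ereal p - enn2ereal n) \<le> p" for p n :: ennreal
  proof -
    have "enn2ereal p - enn2ereal n \<le> enn2ereal p"
      by (cases "enn2ereal p"; cases "enn2ereal n"; use enn2ereal_nonneg[of n] in simp)
    from e2ennreal_mono[OF this] show ?thesis by simp
  qed
  then show ?thesis unfolding ext_integral_def .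
qed

lemma negative_part_le_ext_integral:
  "(\<integral>\<^sup>+ x. e2ennreal (- u x) \<partial>M) \<le> e2ennreal (- ext_integral M u) + (\<integral>\<^sup>+ x. e2ennreal (u x) \<partial>M)"
proof -
  have "n \<le> e2ennreal (- (enn2ereal p - enn2ereal n)) + p" for p n :: ennreal
  proof (cases p; cases n)
    fix r s :: real assume "0 \<le> r" "p = ennreal r" "0 \<le> s" "n = ennreal s"
    then show ?thesis
      by (cases "r \<le> s") (auto simp: ennreal_neg simp flip: ennreal_plus)
  qed auto
  then show ?thesis unfolding ext_integral_def .
qed

lemma pair_measure_eqI_boxes:
  assumes fin: "finite_measure \<mu>"
    and sets: "sets \<mu> = sets (N1 \<Otimes>\<^sub>M N2)" "sets \<nu> = sets (N1 \<Otimes>\<^sub>M N2)"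
    and eq: "\<And>A B. A \<in> sets N1 \<Longrightarrow> B \<in> sets N2 \<Longrightarrow> emeasure \<mu> (A \<times> B) = emeasure \<nu> (A \<times> B)"
  shows "\<mu> = \<nu>"
proof (rule measure_eqI_generator_eq[OF Int_stable_pair_measure_generator[of N1 N2] pair_measure_closed,
      where A = "\<lambda>_. space N1 \<times> space N2"])
  interpret finite_measure \<mu> by fact
  show "\<And>i. emeasure \<mu> (space N1 \<times> space N2) \<noteq> \<infinity>" by simp
qed (use sets in \<open>auto simp: sets_pair_measure eq\<close>)

lemma (in prob_space) cond_law_boxes:
  fixes X :: "'a \<Rightarrow> 'x::topological_space" and Y C :: "'a \<Rightarrow> real"
  assumes [measurable]: "X \<in> borel_measurable M" "Y \<in> borel_measurable M" "C \<in> borel_measurable M"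
    and indep: "cond_indep M X Y C"
    and P: "is_cond_distr M X Y P" and G: "is_cond_distr M X C G"
    and [measurable]: "A \<in> sets borel" "B \<in> sets borel" "D \<in> sets borel"
  shows "emeasure M {w \<in> space M. X w \<in> A \<and> Y w \<in> B \<and> C w \<in> D}
    = (\<integral>\<^sup>+ w. indicator A (X w) * (emeasure (P (X w)) B * emeasure (G (X w)) D) \<partial>M)"
proof -
  let ?S = "vimage_algebra (space M) X borel"
  have "finite_measure_subalgebra M ?S"
    by (auto simp: finite_measure_subalgebra_def finite_measure_subalgebra_axioms_def subalgebra_def
        finite_measure_axioms sets_vimage_algebra2 intro!: measurable_sets[OF assms(1)])
  then interpret sub: sigma_finite_subalgebra M ?S
    by (rule finite_measure_subalgebra_is_sigma_finite)
  let ?A = "X -` A \<inter> space M"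
  let ?E = "Y -` B \<inter> C -` D \<inter> space M"
  have A: "?A \<in> sets ?S" by (simp add: in_vimage_algebra)
  have [measurable]: "?E \<in> sets M" "?A \<in> sets M" by measurable
  have Pk: "P \<in> borel \<rightarrow>\<^sub>M prob_algebra borel" and Gk: "G \<in> borel \<rightarrow>\<^sub>M prob_algebra borel"
    using P G by (auto simp: is_cond_distr_def)
  have prob: "prob_space (P x)" "prob_space (G x)" for x
    using measurable_space[OF Pk, of x] measurable_space[OF Gk, of x] by (auto simp: space_prob_algebra)
  have [measurable]: "(\<lambda>w. measure (P (X w)) B) \<in> borel_measurable M" "(\<lambda>w. measure (G (X w)) D) \<in> borel_measurable M"
    using measurable_compose[OF assms(1) measurable_compose[OF Pk measurable_measure_prob_algebra[of B]]]
      measurable_compose[OF assms(1) measurable_compose[OF Gk measurable_measure_prob_algebra[of D]]] by auto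
  have ae: "AE w in M. real_cond_exp M ?S (indicat_real ?E) w = measure (P (X w)) B * measure (G (X w)) D"
  proof -
    have "AE w in M. real_cond_exp M ?S (indicat_real ?E) w = real_cond_exp M ?S (indicat_real (Y -` B \<inter> space M)) w
            * real_cond_exp M ?S (indicat_real (C -` D \<inter> space M)) w"
      using indep by (simp add: cond_indep_def Let_def)
    moreover have "AE w in M. real_cond_exp M ?S (indicat_real (Y -` B \<inter> space M)) w = measure (P (X w)) B"
      "AE w in M. real_cond_exp M ?S (indicat_real (C -` D \<inter> space M)) w = measure (G (X w)) D"
      using P G by (auto simp: is_cond_distr_def)
    ultimately show ?thesis by eventually_elim simp
  qed
  have "measure M {w \<in> space M. X w \<in> A \<and> Y w \<in> B \<and> C w \<in> D} = measure M (?A \<inter> ?E)"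
    by (rule arg_cong[where f = "measure M"]) auto
  also have "\<dots> = (LINT w:?A|M. indicat_real ?E w)"
    by (simp add: set_lebesgue_integral_def flip: indicator_inter_arith)
  also have "\<dots> = (LINT w:?A|M. real_cond_exp M ?S (indicat_real ?E) w)"
    by (rule sub.real_cond_exp_intA[OF _ A], rule integrable_real_indicator) (auto simp: less_top[symmetric])
  also have "\<dots> = (\<integral>w. indicat_real A (X w) * (measure (P (X w)) B * measure (G (X w)) D) \<partial>M)"
    unfolding set_lebesgue_integral_def
    by (rule integral_cong_AE) (use ae in \<open>auto simp: indicator_def elim!: eventually_mono\<close>)
  finally have *: "measure M {w \<in> space M. X w \<in> A \<and> Y w \<in> B \<and> C w \<in> D}
    = (\<integral>w. indicat_real A (X w) * (measure (P (X w)) B * measure (G (X w)) D) \<partial>M)" .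
  have "integrable M (\<lambda>w. indicat_real A (X w) * (measure (P (X w)) B * measure (G (X w)) D))"
    by (rule integrable_const_bound[of _ 1])
      (auto simp: indicator_def intro!: mult_le_one prob_space.prob_le_1[OF prob(1)] prob_space.prob_le_1[OF prob(2)])
  then have "ennreal (\<integral>w. indicat_real A (X w) * (measure (P (X w)) B * measure (G (X w)) D) \<partial>M)
     = (\<integral>\<^sup>+w. ennreal (indicat_real A (X w) * (measure (P (X w)) B * measure (G (X w)) D)) \<partial>M)"
    by (intro nn_integral_eq_integral[symmetric]) auto
  also have "\<dots> = (\<integral>\<^sup>+ w. indicator A (X w) * (emeasure (P (X w)) B * emeasure (G (X w)) D) \<partial>M)"
    by (intro nn_integral_cong)
      (auto simp: indicator_def ennreal_mult finite_measure.emeasure_eq_measure prob[THEN prob_space.finite_measure])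
  finally show ?thesis
    by (simp add: emeasure_eq_measure *)
qed

text \<open>
  Given \<open>X = x\<close>, the pair \<open>(Y, C)\<close> has the product law \<open>P x \<Otimes>\<^sub>M G x\<close>. The conditional expectations
  only determine the probabilities of boxes; two applications of uniqueness on boxes, first in \<open>(Y, C)\<close>
  for a fixed event of \<open>X\<close> and then in \<open>X\<close> and \<open>(Y, C)\<close>, identify the joint law with a mixture.
\<close>

lemma (in prob_space) nn_integral_cond_law:
  fixes X :: "'a \<Rightarrow> 'x::topological_space" and Y C :: "'a \<Rightarrow> real"
  assumes X[measurable]: "X \<in> borel_measurable M" and Y[measurable]: "Y \<in> borel_measurable M"
    and C[measurable]: "C \<in> borel_measurable M"
    and indep: "cond_indep M X Y C"
    and P: "is_cond_distr M X Y P" and G: "is_cond_distr M X C G"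
    and g[measurable]: "g \<in> borel_measurable (borel \<Otimes>\<^sub>M borel \<Otimes>\<^sub>M borel)"
  shows "(\<integral>\<^sup>+ w. g (X w, Y w, C w) \<partial>M)
    = (\<integral>\<^sup>+ x. \<integral>\<^sup>+ c. \<integral>\<^sup>+ y. g (x, y, c) \<partial>P x \<partial>G x \<partial>distr M borel X)"
proof -
  let ?H = "distr M borel X"
  let ?B2 = "borel \<Otimes>\<^sub>M borel :: (real \<times> real) measure"
  let ?B3 = "borel \<Otimes>\<^sub>M ?B2 :: ('x \<times> real \<times> real) measure"
  have Pk: "P \<in> borel \<rightarrow>\<^sub>M prob_algebra borel" and Gk: "G \<in> borel \<rightarrow>\<^sub>M prob_algebra borel"
    using P G by (auto simp: is_cond_distr_def)
  have prob: "prob_space (P x)" "prob_space (G x)" and sets_PG: "sets (P x) = sets borel" "sets (G x) = sets borel" for x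
    using measurable_space[OF Pk, of x] measurable_space[OF Gk, of x] by (auto simp: space_prob_algebra)
  have PGk[measurable]: "(\<lambda>x. P x \<Otimes>\<^sub>M G x) \<in> borel \<rightarrow>\<^sub>M subprob_algebra ?B2"
    by (intro measurable_pair_measure measurable_prob_algebraD Pk Gk)
  have sets_PG2[simp, measurable_cong]: "sets (P x \<Otimes>\<^sub>M G x) = sets ?B2" for x
    by (intro sets_pair_measure_cong sets_PG)
  have space_PG: "space (P x \<Otimes>\<^sub>M G x) = UNIV" for x
    using sets_eq_imp_space_eq[OF sets_PG2] by (simp add: space_pair_measure)
  have box1: "emeasure M {w \<in> space M. X w \<in> A \<and> (Y w, C w) \<in> E}
      = (\<integral>\<^sup>+ w. indicator A (X w) * emeasure (P (X w) \<Otimes>\<^sub>M G (X w)) E \<partial>M)"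
    if A[measurable]: "A \<in> sets borel" and E[measurable]: "E \<in> sets ?B2" for A E
  proof -
    let ?\<mu> = "distr (density M (\<lambda>w. indicator A (X w))) ?B2 (\<lambda>w. (Y w, C w))"
    let ?\<nu> = "density ?H (indicator A) \<bind> (\<lambda>x. P x \<Otimes>\<^sub>M G x)"
    have mu: "emeasure ?\<mu> E = emeasure M {w \<in> space M. X w \<in> A \<and> (Y w, C w) \<in> E}"
      if [measurable]: "E \<in> sets ?B2" for E
    proof -
      let ?V = "{w \<in> space M. (Y w, C w) \<in> E}"
      have "emeasure ?\<mu> E = emeasure (density M (\<lambda>w. indicator A (X w))) ?V"
        by (subst emeasure_distr) (auto intro!: arg_cong2[where f = emeasure])
      also have "\<dots> = (\<integral>\<^sup>+ w. indicator A (X w) * indicator ?V w \<partial>M)"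
        by (rule emeasure_density) measurable
      also have "\<dots> = (\<integral>\<^sup>+ w. indicator {w \<in> space M. X w \<in> A \<and> (Y w, C w) \<in> E} w \<partial>M)"
        by (rule nn_integral_cong) (auto simp: indicator_def)
      also have "\<dots> = emeasure M {w \<in> space M. X w \<in> A \<and> (Y w, C w) \<in> E}"
        by (rule nn_integral_indicator) measurable
      finally show ?thesis .
    qed
    have nu: "emeasure ?\<nu> E = (\<integral>\<^sup>+ w. indicator A (X w) * emeasure (P (X w) \<Otimes>\<^sub>M G (X w)) E \<partial>M)"
      if [measurable]: "E \<in> sets ?B2" for E
    proof -
      have [measurable]: "(\<lambda>x. emeasure (P x \<Otimes>\<^sub>M G x) E) \<in> borel_measurable borel"
        by (rule measurable_compose[OF PGk]) measurable
      show ?thesis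
        by (subst emeasure_bind[where N = ?B2])
          (auto simp: nn_integral_density nn_integral_distr space_PG)
    qed
    have "?\<mu> = ?\<nu>"
    proof (rule pair_measure_eqI_boxes)
      show "finite_measure ?\<mu>"
        using mu[of UNIV] sets.top[of ?B2] by (intro finite_measureI) (auto simp: emeasure_eq_measure space_pair_measure)
      show "sets ?\<mu> = sets ?B2" by simp
      show "sets ?\<nu> = sets ?B2" by (rule sets_bind) auto
      fix B D :: "real set" assume [measurable]: "B \<in> sets borel" "D \<in> sets borel"
      have "emeasure (P x \<Otimes>\<^sub>M G x) (B \<times> D) = emeasure (P x) B * emeasure (G x) D" for x
      proof -
        interpret Gx: prob_space "G x" by (rule prob)
        show ?thesis by (rule Gx.emeasure_pair_measure_Times) (auto simp: sets_PG)
      qed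
      then show "emeasure ?\<mu> (B \<times> D) = emeasure ?\<nu> (B \<times> D)"
        using cond_law_boxes[OF X Y C indep P G, of A B D] by (simp add: mu nu)
    qed
    with mu[OF E] nu[OF E] show ?thesis by simp
  qed
  let ?k = "\<lambda>x. distr (P x \<Otimes>\<^sub>M G x) ?B3 (\<lambda>z. (x, z))"
  have k: "?k \<in> borel \<rightarrow>\<^sub>M subprob_algebra ?B3"
    by (rule measurable_distr2[OF _ PGk]) measurable
  have k': "?k \<in> ?H \<rightarrow>\<^sub>M subprob_algebra ?B3"
    using k by simp
  have law: "distr M ?B3 (\<lambda>w. (X w, Y w, C w)) = ?H \<bind> ?k"
  proof (rule pair_measure_eqI_boxes)
    show "finite_measure (distr M ?B3 (\<lambda>w. (X w, Y w, C w)))"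
      by (intro finite_measure_distr) measurable
    show "sets (?H \<bind> ?k) = sets ?B3" by (rule sets_bind) auto
    fix A :: "'x set" and E :: "(real \<times> real) set" assume [measurable]: "A \<in> sets borel" "E \<in> sets ?B2"
    have [measurable]: "(\<lambda>x. emeasure (P x \<Otimes>\<^sub>M G x) E) \<in> borel_measurable borel"
      by (rule measurable_compose[OF PGk]) measurable
    have "emeasure (?k x) (A \<times> E) = indicator A x * emeasure (P x \<Otimes>\<^sub>M G x) E" for x
      by (subst emeasure_distr) (auto simp: space_PG indicator_def vimage_def)
    then have "emeasure (?H \<bind> ?k) (A \<times> E) = (\<integral>\<^sup>+ w. indicator A (X w) * emeasure (P (X w) \<Otimes>\<^sub>M G (X w)) E \<partial>M)"
      by (subst emeasure_bind[OF _ k']) (auto simp: nn_integral_distr)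
    moreover have "emeasure (distr M ?B3 (\<lambda>w. (X w, Y w, C w))) (A \<times> E) = emeasure M {w \<in> space M. X w \<in> A \<and> (Y w, C w) \<in> E}"
      by (subst emeasure_distr) (auto intro!: arg_cong[where f = "emeasure M"])
    ultimately show "emeasure (distr M ?B3 (\<lambda>w. (X w, Y w, C w))) (A \<times> E) = emeasure (?H \<bind> ?k) (A \<times> E)"
      by (simp add: box1)
  qed simp
  have inner: "(\<integral>\<^sup>+ z. g z \<partial>?k x) = (\<integral>\<^sup>+ c. \<integral>\<^sup>+ y. g (x, y, c) \<partial>P x \<partial>G x)" for x
  proof -
    interpret Px: prob_space "P x" by (rule prob)
    interpret Gx: prob_space "G x" by (rule prob)
    interpret PG: pair_prob_space "P x" "G x" by unfold_locales
    note sets_PG[measurable_cong]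
    have "(\<integral>\<^sup>+ z. g z \<partial>?k x) = (\<integral>\<^sup>+ z. g (x, z) \<partial>(P x \<Otimes>\<^sub>M G x))"
      by (subst nn_integral_distr) auto
    also have "\<dots> = (\<integral>\<^sup>+ c. \<integral>\<^sup>+ y. g (x, y, c) \<partial>P x \<partial>G x)"
      by (rule PG.nn_integral_snd[symmetric]) measurable
    finally show ?thesis .
  qed
  have "(\<integral>\<^sup>+ w. g (X w, Y w, C w) \<partial>M) = (\<integral>\<^sup>+ z. g z \<partial>distr M ?B3 (\<lambda>w. (X w, Y w, C w)))"
    by (subst nn_integral_distr) auto
  also have "\<dots> = (\<integral>\<^sup>+ x. \<integral>\<^sup>+ z. g z \<partial>?k x \<partial>?H)"
    unfolding law by (rule nn_integral_bind[OF g k'])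
  finally show ?thesis by (simp only: inner)
qed

section \<open>The censored regression model\<close>

text \<open>
  The observation is a triple consisting of the covariate, the censored time, and the indicator that
  the time is uncensored.
\<close>

definition obs_loglik ::
  "real measure \<Rightarrow> ('t \<Rightarrow> 'x \<Rightarrow> real \<Rightarrow> real) \<Rightarrow> 'x \<times> real \<times> real \<Rightarrow> 't \<Rightarrow> real" where
  "obs_loglik nu f = (\<lambda>(x, z, d) t. d * ln (f t x z) + (1 - d) * log_surv nu f t x z)"

lemma loglik_eq_sum_obs_loglik:
  "loglik nu f Xs Zs ds n w t = (\<Sum>i<n. obs_loglik nu f (Xs i w, Zs i w, ds i w) t)"
  by (simp add: loglik_def obs_loglik_def)

locale censored_regression = prob_space M
  for M :: "'w measure" +
  fixes nu :: "real measure" and \<Theta> :: "(real^'q) set"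
    and f :: "real^'q \<Rightarrow> real^'p \<Rightarrow> real \<Rightarrow> real" and \<theta>0 :: "real^'q"
    and X :: "'w \<Rightarrow> real^'p" and Y C :: "'w \<Rightarrow> real" and G :: "real^'p \<Rightarrow> real measure"
  assumes sets_nu[measurable_cong, simp]: "sets nu = sets borel"
    and sigma_finite_nu: "sigma_finite_measure nu"
    and nu_negative: "emeasure nu {..<0} = 0"
    and family: "density_family nu (distr M borel X) \<Theta> f"
    and true_param: "\<theta>0 \<in> \<Theta>"
    and X[measurable]: "X \<in> borel_measurable M" and Y[measurable]: "Y \<in> borel_measurable M"
    and C[measurable]: "C \<in> borel_measurable M"
    and indep_given_X: "cond_indep M X Y C"
    and law_Y: "is_cond_distr M X Y (\<lambda>x. density nu (\<lambda>y. ennreal (f \<theta>0 x y)))"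
    and law_C: "is_cond_distr M X C G"
    and continuous_density: "\<And>x y. 0 \<le> y \<Longrightarrow> continuous_on \<Theta> (\<lambda>\<theta>. f \<theta> x y)"
begin

abbreviation "H \<equiv> distr M borel X"
abbreviation "F \<equiv> cond_cdf nu f"
abbreviation "obs w \<equiv> (X w, min (Y w) (C w), of_bool (Y w \<le> C w) :: real)"
abbreviation "l \<equiv> obs_loglik nu f"

definition P_obs :: "((real^'p) \<times> real \<times> real) measure" where
  "P_obs = distr M borel obs"

sublocale nu: sigma_finite_measure nu by (rule sigma_finite_nu)

lemma space_nu[simp]: "space nu = UNIV"
  using sets_eq_imp_space_eq[OF sets_nu] by simp

lemma kernel_C[measurable]: "G \<in> borel \<rightarrow>\<^sub>M prob_algebra borel"
  using law_C by (simp add: is_cond_distr_def)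

lemma prob_space_G: "prob_space (G x)" and sets_G[measurable_cong, simp]: "sets (G x) = sets borel"
  using measurable_space[OF kernel_C, of x] by (auto simp: space_prob_algebra)

lemma density_measurable[measurable (raw)]:
  assumes t: "t \<in> \<Theta>" and [measurable]: "u \<in> N \<rightarrow>\<^sub>M borel" "v \<in> N \<rightarrow>\<^sub>M borel"
  shows "(\<lambda>z. f t (u z) (v z)) \<in> borel_measurable N"
proof -
  have [measurable]: "(\<lambda>(x, y). f t x y) \<in> borel_measurable (borel \<Otimes>\<^sub>M borel)"
    using family t by (simp add: density_family_def)
  have "(\<lambda>z. (\<lambda>(x, y). f t x y) (u z, v z)) \<in> borel_measurable N" by measurable
  then show ?thesis by simp
qed

lemma density_nonneg: "t \<in> \<Theta> \<Longrightarrow> 0 \<le> y \<Longrightarrow> 0 \<le> f t x y"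
  using family by (simp add: density_family_def)

lemma AE_nu_nonneg: "AE y in nu. 0 \<le> y"
  using nu_negative by (intro AE_I[of _ _ "{..<0}"]) auto

lemma nn_integral_density_1: "t \<in> \<Theta> \<Longrightarrow> (\<integral>\<^sup>+ y. ennreal (f t x y) \<partial>nu) = 1"
  using family by (simp add: density_family_def)

lemma integrable_density: "t \<in> \<Theta> \<Longrightarrow> integrable nu (f t x)"
proof (rule integrableI_bounded)
  assume t: "t \<in> \<Theta>"
  then show "f t x \<in> borel_measurable nu" by measurable
  have "(\<integral>\<^sup>+ y. ennreal (norm (f t x y)) \<partial>nu) = (\<integral>\<^sup>+ y. ennreal (f t x y) \<partial>nu)"
    by (rule nn_integral_cong_AE) (use AE_nu_nonneg in eventually_elim, simp add: density_nonneg t)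
  then show "(\<integral>\<^sup>+ y. ennreal (norm (f t x y)) \<partial>nu) < \<infinity>"
    using nn_integral_density_1[OF t] by simp
qed

lemma
  assumes t: "t \<in> \<Theta>"
  shows cond_cdf_nonneg: "0 \<le> F t x c" and cond_cdf_le_1: "F t x c \<le> 1"
    and ennreal_cond_cdf: "ennreal (F t x c) = (\<integral>\<^sup>+ y. ennreal (f t x y) * indicator {..c} y \<partial>nu)"
    and ennreal_survival: "ennreal (1 - F t x c) = (\<integral>\<^sup>+ y. ennreal (f t x y) * indicator {c<..} y \<partial>nu)"
proof -
  have nonneg: "AE y in nu. 0 \<le> f t x y"
    using AE_nu_nonneg by eventually_elim (simp add: density_nonneg t)
  note [measurable] = t
  have int: "integrable nu (\<lambda>y. indicator A y * f t x y)" if "A \<in> sets borel" for A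
    using integrable_mult_indicator[of A nu "f t x"] integrable_density[OF t, of x] that by simp
  have F: "F t x c = (\<integral>y. indicator {..c} y * f t x y \<partial>nu)"
    by (simp add: cond_cdf_def set_lebesgue_integral_def)
  have conv: "ennreal (\<integral>y. indicator A y * f t x y \<partial>nu) = (\<integral>\<^sup>+ y. ennreal (f t x y) * indicator A y \<partial>nu)"
    if A: "A \<in> sets borel" for A
  proof -
    have "ennreal (\<integral>y. indicator A y * f t x y \<partial>nu) = (\<integral>\<^sup>+ y. ennreal (indicator A y * f t x y) \<partial>nu)"
      by (rule nn_integral_eq_integral[symmetric, OF int[OF A]])
        (use nonneg in \<open>auto elim!: eventually_mono simp: indicator_def\<close>)
    also have "\<dots> = (\<integral>\<^sup>+ y. ennreal (f t x y) * indicator A y \<partial>nu)"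
      by (rule nn_integral_cong) (auto simp: indicator_def)
    finally show ?thesis .
  qed
  show F0: "0 \<le> F t x c" unfolding F
    by (rule integral_nonneg_AE) (use nonneg in \<open>auto elim!: eventually_mono simp: indicator_def\<close>)
  show eF: "ennreal (F t x c) = (\<integral>\<^sup>+ y. ennreal (f t x y) * indicator {..c} y \<partial>nu)"
    unfolding F by (rule conv) simp
  let ?S = "\<integral>y. indicator {c<..} y * f t x y \<partial>nu"
  have S0: "0 \<le> ?S"
    by (rule integral_nonneg_AE) (use nonneg in \<open>auto elim!: eventually_mono simp: indicator_def\<close>)
  have "(\<integral>y. f t x y \<partial>nu) = 1"
    using nn_integral_eq_integral[OF integrable_density[OF t] nonneg] nn_integral_density_1[OF t, of x]
    by (simp add: integral_nonneg_AE[OF nonneg])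
  also have "(\<integral>y. f t x y \<partial>nu) = F t x c + ?S"
    unfolding F Bochner_Integration.integral_add[OF int[of "{..c}"] int[of "{c<..}"], simplified, symmetric]
    by (rule Bochner_Integration.integral_cong) (auto simp: indicator_def)
  finally have S: "1 - F t x c = ?S" by simp
  with S0 show "F t x c \<le> 1" by simp
  show "ennreal (1 - F t x c) = (\<integral>\<^sup>+ y. ennreal (f t x y) * indicator {c<..} y \<partial>nu)"
    unfolding S by (rule conv) simp
qed

lemma cond_cdf_measurable[measurable (raw)]:
  assumes t: "t \<in> \<Theta>" and [measurable]: "u \<in> N \<rightarrow>\<^sub>M borel" "v \<in> N \<rightarrow>\<^sub>M borel"
  shows "(\<lambda>z. F t (u z) (v z)) \<in> borel_measurable N"
proof -
  note [measurable] = t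
  have F: "F t x c = (\<integral>y. of_bool (y \<le> c) * f t x y \<partial>nu)" for x c
    unfolding cond_cdf_def set_lebesgue_integral_def
    by (rule Bochner_Integration.integral_cong) (auto simp: indicator_def)
  have "(\<lambda>(z, y). of_bool (y \<le> snd z) * f t (fst z) y) \<in> borel_measurable ((borel \<Otimes>\<^sub>M borel) \<Otimes>\<^sub>M borel)"
    unfolding split_beta by (intro borel_measurable_times density_measurable[OF t]) measurable
  then have "(\<lambda>(z, y). of_bool (y \<le> snd z) * f t (fst z) y) \<in> borel_measurable ((borel \<Otimes>\<^sub>M borel) \<Otimes>\<^sub>M nu)"
    by (simp add: measurable_cong_sets[OF sets_pair_measure_cong[OF refl sets_nu] refl])
  then have "(\<lambda>z. F t (fst z) (snd z)) \<in> borel_measurable (borel \<Otimes>\<^sub>M borel)"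
    unfolding F by (rule nu.borel_measurable_lebesgue_integral)
  from measurable_compose[OF _ this, of "\<lambda>z. (u z, v z)" N] show ?thesis by simp
qed

lemma log_surv_measurable[measurable (raw)]:
  assumes [measurable]: "t \<in> \<Theta>" "u \<in> N \<rightarrow>\<^sub>M borel" "v \<in> N \<rightarrow>\<^sub>M borel"
  shows "(\<lambda>z. log_surv nu f t (u z) (v z)) \<in> borel_measurable N"
  unfolding log_surv_def by measurable

lemma obs_loglik_measurable[measurable]:
  assumes [measurable]: "t \<in> \<Theta>"
  shows "(\<lambda>z. l z t) \<in> borel_measurable (borel \<Otimes>\<^sub>M borel \<Otimes>\<^sub>M borel)"
  unfolding obs_loglik_def split_beta by measurable

text \<open>
  Scheffe's lemma: the densities converge pointwise and all have integral one, hence they converge in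
  \<open>L1\<close>, and so do their integrals over \<open>{..c}\<close>.
\<close>

lemma continuous_on_cond_cdf: "continuous_on \<Theta> (\<lambda>t. F t x c)"
  unfolding continuous_on_sequentially
proof (intro allI ballI impI)
  fix s a assume a: "a \<in> \<Theta>" and "(\<forall>n. s n \<in> \<Theta>) \<and> s \<longlonglongrightarrow> a"
  then have s: "\<And>n. s n \<in> \<Theta>" "s \<longlonglongrightarrow> a" by auto
  note [measurable] = a s(1)
  have norm: "(\<integral>\<^sup>+ y. ennreal (norm (f t x y)) \<partial>nu) = 1" if t: "t \<in> \<Theta>" for t
  proof -
    have "(\<integral>\<^sup>+ y. ennreal (norm (f t x y)) \<partial>nu) = (\<integral>\<^sup>+ y. ennreal (f t x y) \<partial>nu)"
      by (rule nn_integral_cong_AE) (use AE_nu_nonneg in eventually_elim, simp add: density_nonneg t)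
    then show ?thesis by (simp add: nn_integral_density_1 t)
  qed
  have lim: "(\<lambda>n. \<integral>\<^sup>+ y. norm (f (s n) x y - f a x y) \<partial>nu) \<longlonglongrightarrow> 0"
  proof (rule Scheffe_lemma2)
    show "AE y in nu. (\<lambda>n. f (s n) x y) \<longlonglongrightarrow> f a x y"
      using AE_nu_nonneg
    proof eventually_elim
      case (elim y)
      from continuous_density[OF elim, of x] s a show ?case
        by (auto simp: continuous_on_sequentially o_def)
    qed
  qed (simp_all add: norm a s integrable_density del: real_norm_def)
  have bound: "ennreal (norm (F (s n) x c - F a x c)) \<le> (\<integral>\<^sup>+ y. norm (f (s n) x y - f a x y) \<partial>nu)" for n
  proof -
    have int: "integrable nu (\<lambda>y. indicator {..c} y * f t x y)" if t: "t \<in> \<Theta>" for t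
      using integrable_mult_indicator[of "{..c}" nu "f t x"] integrable_density[OF t, of x] by simp
    have "F (s n) x c - F a x c = (\<integral>y. indicator {..c} y * f (s n) x y - indicator {..c} y * f a x y \<partial>nu)"
      unfolding cond_cdf_def set_lebesgue_integral_def using int s(1) a by simp
    also have "ennreal (norm \<dots>) \<le> (\<integral>\<^sup>+ y. norm (indicator {..c} y * f (s n) x y - indicator {..c} y * f a x y) \<partial>nu)"
      using int s(1) a by (intro integral_norm_bound_ennreal) auto
    also have "\<dots> \<le> (\<integral>\<^sup>+ y. norm (f (s n) x y - f a x y) \<partial>nu)"
      by (rule nn_integral_mono) (auto simp: indicator_def)
    finally show ?thesis .
  qed
  have "(\<lambda>n. ennreal (norm (F (s n) x c - F a x c))) \<longlonglongrightarrow> 0"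
    by (rule tendsto_sandwich[OF _ _ tendsto_const lim]) (use bound in auto)
  then have "(\<lambda>n. norm (F (s n) x c - F a x c)) \<longlonglongrightarrow> 0"
    by (simp flip: ennreal_0)
  then show "((\<lambda>t. F t x c) \<circ> s) \<longlonglongrightarrow> F a x c"
    by (simp add: o_def tendsto_rabs_zero_iff LIM_zero_iff)
qed

text \<open>
  At a regular covariate all conditional laws of the family have the same null sets as \<open>nu\<close>. The
  point is that the exceptional set does not depend on the parameter, so that the convention for
  \<open>log_surv\<close> at \<open>F = 1\<close> applies to all parameters or to none.
\<close>

definition regular :: "real^'p \<Rightarrow> bool" where
  "regular x \<longleftrightarrow> (AE y in nu. \<forall>t\<in>\<Theta>. 0 < f t x y)"

lemma cond_cdf_eq_1_iff:
  assumes x: "regular x" and t: "t \<in> \<Theta>"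
  shows "F t x c = 1 \<longleftrightarrow> (AE y in nu. y \<le> c)"
proof -
  note [measurable] = t
  have "F t x c = 1 \<longleftrightarrow> ennreal (1 - F t x c) = 0"
    using cond_cdf_le_1[OF t, of x c] by (auto simp: ennreal_eq_0_iff)
  also have "\<dots> \<longleftrightarrow> (AE y in nu. ennreal (f t x y) * indicator {c<..} y = 0)"
    unfolding ennreal_survival[OF t] by (rule nn_integral_0_iff_AE) measurable
  also have "\<dots> \<longleftrightarrow> (AE y in nu. y \<le> c)"
  proof -
    have "AE y in nu. (ennreal (f t x y) * indicator {c<..} y = 0) = (y \<le> c)"
      using x unfolding regular_def
      by eventually_elim (use t in \<open>auto simp: indicator_def ennreal_eq_0_iff not_le not_less split: if_splits\<close>)
    then show ?thesis by (auto elim: eventually_elim2)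
  qed
  finally show ?thesis .
qed


sublocale H_nu: pair_sigma_finite H nu
  by (intro pair_sigma_finite.intro prob_space_imp_sigma_finite prob_space_distr X sigma_finite_nu)

lemma AE_regular: "AE x in H. regular x"
proof -
  have "AE z in H \<Otimes>\<^sub>M nu. case z of (x, y) \<Rightarrow> \<forall>t\<in>\<Theta>. 0 < f t x y"
    using family by (simp add: density_family_def)
  from H_nu.AE_pair[OF this] show ?thesis by (simp add: regular_def)
qed

text \<open>
  The law of \<open>(X, Y)\<close> is absolutely continuous with respect to \<open>H \<Otimes>\<^sub>M nu\<close>.
\<close>

lemma AE_not_in_null_set:
  assumes N: "N \<in> null_sets (H \<Otimes>\<^sub>M nu)"
  shows "AE w in M. (X w, Y w) \<notin> N"
proof -
  have "N \<in> sets (H \<Otimes>\<^sub>M nu)" using N by auto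
  also have "sets (H \<Otimes>\<^sub>M nu) = sets (borel \<Otimes>\<^sub>M borel)" by (intro sets_pair_measure_cong) auto
  finally have [measurable]: "N \<in> sets (borel \<Otimes>\<^sub>M borel)" .
  have f0: "(\<lambda>y. ennreal (f \<theta>0 x y)) \<in> borel_measurable nu" for x
    using true_param by measurable
  have "AE x in H. AE y in nu. (x, y) \<notin> N"
    using H_nu.AE_pair[OF AE_not_in[OF N]] .
  then have zero: "AE x in H. (\<integral>\<^sup>+ c. \<integral>\<^sup>+ y. indicator N (x, y) \<partial>density nu (\<lambda>y. ennreal (f \<theta>0 x y)) \<partial>G x) = 0"
  proof eventually_elim
    case (elim x)
    have "(\<integral>\<^sup>+ y. indicator N (x, y) \<partial>density nu (\<lambda>y. ennreal (f \<theta>0 x y)))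
        = (\<integral>\<^sup>+ y. ennreal (f \<theta>0 x y) * indicator N (x, y) \<partial>nu)"
      by (rule nn_integral_density[OF f0]) measurable
    also have "\<dots> = (\<integral>\<^sup>+ y. 0 \<partial>nu)"
      by (rule nn_integral_cong_AE) (use elim in eventually_elim, simp)
    finally show ?case by simp
  qed
  have "(\<integral>\<^sup>+ w. indicator N (X w, Y w) \<partial>M)
      = (\<integral>\<^sup>+ x. \<integral>\<^sup>+ c. \<integral>\<^sup>+ y. indicator N (x, y) \<partial>density nu (\<lambda>y. ennreal (f \<theta>0 x y)) \<partial>G x \<partial>H)"
    using nn_integral_cond_law[OF X Y C indep_given_X law_Y law_C, of "\<lambda>z. indicator N (fst z, fst (snd z))"]
    by simp
  also have "\<dots> = (\<integral>\<^sup>+ x. 0 \<partial>H)"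
    by (rule nn_integral_cong_AE[OF zero])
  also have "\<dots> = 0" by simp
  finally have "AE w in M. indicator N (X w, Y w) = (0::ennreal)"
    by (subst (asm) nn_integral_0_iff_AE) auto
  then show ?thesis by eventually_elim (auto simp: indicator_def split: if_splits)
qed

lemma AE_Y_nonneg: "AE w in M. 0 \<le> Y w"
proof -
  have "UNIV \<times> {..<0} \<in> null_sets (H \<Otimes>\<^sub>M nu)"
    by (auto simp: null_sets_def nu.emeasure_pair_measure_Times nu_negative)
  from AE_not_in_null_set[OF this] show ?thesis by eventually_elim auto
qed

text \<open>
  The set where all densities are positive involves uncountably many parameters and may fail to be
  measurable; a measurable null set covering its complement replaces it.
\<close>

lemma positive_off_null_set:
  obtains N where "N \<in> null_sets (H \<Otimes>\<^sub>M nu)" "\<And>x y t. (x, y) \<notin> N \<Longrightarrow> t \<in> \<Theta> \<Longrightarrow> 0 < f t x y"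
proof -
  have "AE z in H \<Otimes>\<^sub>M nu. case z of (x, y) \<Rightarrow> \<forall>t\<in>\<Theta>. 0 < f t x y"
    using family by (simp add: density_family_def)
  then obtain N where N: "{z \<in> space (H \<Otimes>\<^sub>M nu). \<not> (case z of (x, y) \<Rightarrow> \<forall>t\<in>\<Theta>. 0 < f t x y)} \<subseteq> N"
    "emeasure (H \<Otimes>\<^sub>M nu) N = 0" "N \<in> sets (H \<Otimes>\<^sub>M nu)" by (rule AE_E)
  show thesis
  proof
    show "N \<in> null_sets (H \<Otimes>\<^sub>M nu)" using N by auto
    show "0 < f t x y" if "(x, y) \<notin> N" "t \<in> \<Theta>" for x y t
      using N(1) that by (auto simp: space_pair_measure)
  qed
qed

lemma measurable_obs[measurable]: "(\<lambda>w. obs w) \<in> M \<rightarrow>\<^sub>M borel \<Otimes>\<^sub>M borel \<Otimes>\<^sub>M borel"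
  by measurable

lemma P_obs_eq: "P_obs = distr M (borel \<Otimes>\<^sub>M borel \<Otimes>\<^sub>M borel) obs"
  by (simp add: P_obs_def borel_prod)

lemma sets_P_obs[measurable_cong, simp]: "sets P_obs = sets (borel \<Otimes>\<^sub>M borel \<Otimes>\<^sub>M borel)"
  by (simp add: P_obs_eq)

lemma prob_space_P_obs: "prob_space P_obs"
  unfolding P_obs_eq by (rule prob_space_distr) measurable

text \<open>
  The convention for \<open>F = 1\<close> would create a jump if \<open>F\<close> reached one only for some parameters, which
  regularity of the covariate excludes.
\<close>

lemma continuous_on_log_surv:
  assumes x: "regular x"
  shows "continuous_on \<Theta> (\<lambda>t. log_surv nu f t x c)"
proof (cases "AE y in nu. y \<le> c")
  case True
  then have "log_surv nu f t x c = 0" if "t \<in> \<Theta>" for t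
    using cond_cdf_eq_1_iff[OF x that] by (simp add: log_surv_def)
  then show ?thesis using continuous_on_cong[of \<Theta> \<Theta> _ "\<lambda>_. 0::real"] by fastforce
next
  case False
  then have ne: "F t x c \<noteq> 1" if "t \<in> \<Theta>" for t
    using cond_cdf_eq_1_iff[OF x that] by simp
  have "continuous_on \<Theta> (\<lambda>t. ln (1 - F t x c))"
    using ne by (intro continuous_on_ln continuous_on_diff continuous_on_const continuous_on_cond_cdf) auto
  then show ?thesis
    by (rule continuous_on_cong[THEN iffD1, rotated 2]) (use ne in \<open>auto simp: log_surv_def\<close>)
qed

text \<open>
  Transporting an almost sure property from the sample space to the law of an observation requires a
  measurable set of observations. Such a set is \<open>good\<close>: an uncensored pair avoids the null set where
  some density vanishes, and a censored one has a covariate for which the section of this null set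
  is again null.
\<close>

lemma AE_obs_loglik_continuous: "AE z in P_obs. continuous_on \<Theta> (l z)"
proof -
  obtain N where N: "N \<in> null_sets (H \<Otimes>\<^sub>M nu)" and pos: "\<And>x y t. (x, y) \<notin> N \<Longrightarrow> t \<in> \<Theta> \<Longrightarrow> 0 < f t x y"
    by (rule positive_off_null_set) blast
  have "N \<in> sets (H \<Otimes>\<^sub>M nu)" using N by auto
  also have "sets (H \<Otimes>\<^sub>M nu) = sets (borel \<Otimes>\<^sub>M nu)" by (intro sets_pair_measure_cong) auto
  finally have N': "N \<in> sets (borel \<Otimes>\<^sub>M nu)" .
  also have "sets (borel \<Otimes>\<^sub>M nu) = sets (borel \<Otimes>\<^sub>M borel)" by (intro sets_pair_measure_cong) auto
  finally have N''[measurable]: "N \<in> sets (borel \<Otimes>\<^sub>M borel)" .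
  let ?e = "\<lambda>x. emeasure nu (Pair x -` N)"
  have [measurable]: "?e \<in> borel_measurable borel"
    by (rule nu.measurable_emeasure_Pair[OF N'])
  have sec: "Pair x -` N \<in> sets nu" for x
    using sets_Pair1[OF N'] .
  have reg: "regular x" if "?e x = 0" for x
  proof -
    have "AE y in nu. y \<notin> Pair x -` N"
      using sec that by (intro AE_not_in) auto
    then show ?thesis unfolding regular_def by eventually_elim (use pos in auto)
  qed
  define good where "good z \<longleftrightarrow> (snd (snd z) = (1::real) \<and> (fst z, fst (snd z)) \<notin> N \<and> 0 \<le> fst (snd z))
      \<or> (snd (snd z) = 0 \<and> ?e (fst z) = 0)" for z :: "(real^'p) \<times> real \<times> real"
  have good_meas: "Measurable.pred (borel \<Otimes>\<^sub>M borel \<Otimes>\<^sub>M borel) good"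
    unfolding good_def by measurable
  have "AE x in H. AE y in nu. (x, y) \<notin> N"
    using H_nu.AE_pair[OF AE_not_in[OF N]] .
  then have "AE x in H. ?e x = 0"
    by eventually_elim (use sec in \<open>auto simp: AE_iff_null vimage_def null_sets_def\<close>)
  then have "AE w in M. ?e (X w) = 0"
    by (rule AE_distrD[OF X])
  with AE_Y_nonneg AE_not_in_null_set[OF N] have "AE w in M. good (obs w)"
    by eventually_elim (auto simp: good_def min_def)
  then have "AE z in P_obs. good z"
    unfolding P_obs_eq by (subst AE_distr_iff) (use good_meas in \<open>auto simp: pred_def\<close>)
  then show ?thesis
  proof eventually_elim
    case (elim z)
    obtain x y d where z: "z = (x, y, d)" by (cases z)
    from elim consider "d = 1" "(x, y) \<notin> N" "0 \<le> y" | "d = 0" "regular x"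
      using reg by (auto simp: good_def z)
    then show ?case
    proof cases
      case 1
      have "continuous_on \<Theta> (\<lambda>t. ln (f t x y))"
        by (intro continuous_on_ln continuous_density 1) (use pos[OF 1(2)] in fastforce)
      with 1 show ?thesis by (simp add: z obs_loglik_def)
    next
      case 2
      with continuous_on_log_surv[of x y] show ?thesis by (simp add: z obs_loglik_def)
    qed
  qed
qed

text \<open>
  Integration over \<open>y\<close> splits at the censoring time \<open>c\<close>: for \<open>y \<le> c\<close> the observation is \<open>(x, y, 1)\<close>,
  and the remaining mass \<open>1 - F \<theta>0 x c\<close> sits at \<open>(x, c, 0)\<close>.
\<close>

lemma nn_integral_P_obs:
  assumes g[measurable]: "g \<in> borel_measurable (borel \<Otimes>\<^sub>M borel \<Otimes>\<^sub>M borel)"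
  shows "(\<integral>\<^sup>+ z. g z \<partial>P_obs) = (\<integral>\<^sup>+ x. \<integral>\<^sup>+ c.
      (\<integral>\<^sup>+ y. ennreal (f \<theta>0 x y) * (indicator {..c} y * g (x, y, 1)) \<partial>nu)
      + ennreal (1 - F \<theta>0 x c) * g (x, c, 0) \<partial>G x \<partial>H)"
proof -
  note t = true_param
  have f0[measurable]: "(\<lambda>y. ennreal (f \<theta>0 x y)) \<in> borel_measurable nu" for x
    using true_param by measurable
  have "(\<integral>\<^sup>+ z. g z \<partial>P_obs) = (\<integral>\<^sup>+ w. g (obs w) \<partial>M)"
    unfolding P_obs_eq by (rule nn_integral_distr) measurable
  also have "\<dots> = (\<integral>\<^sup>+ x. \<integral>\<^sup>+ c. \<integral>\<^sup>+ y. g (x, min y c, of_bool (y \<le> c))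
      \<partial>density nu (\<lambda>y. ennreal (f \<theta>0 x y)) \<partial>G x \<partial>H)"
    using nn_integral_cond_law[OF X Y C indep_given_X law_Y law_C,
        of "\<lambda>z. g (fst z, min (fst (snd z)) (snd (snd z)), of_bool (fst (snd z) \<le> snd (snd z)))"]
    by simp
  also have "\<dots> = (\<integral>\<^sup>+ x. \<integral>\<^sup>+ c.
      (\<integral>\<^sup>+ y. ennreal (f \<theta>0 x y) * (indicator {..c} y * g (x, y, 1)) \<partial>nu)
      + ennreal (1 - F \<theta>0 x c) * g (x, c, 0) \<partial>G x \<partial>H)"
  proof (intro nn_integral_cong)
    fix x c
    have "(\<integral>\<^sup>+ y. g (x, min y c, of_bool (y \<le> c)) \<partial>density nu (\<lambda>y. ennreal (f \<theta>0 x y)))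
      = (\<integral>\<^sup>+ y. ennreal (f \<theta>0 x y) * g (x, min y c, of_bool (y \<le> c)) \<partial>nu)"
      by (rule nn_integral_density) measurable
    also have "\<dots> = (\<integral>\<^sup>+ y. ennreal (f \<theta>0 x y) * (indicator {..c} y * g (x, y, 1))
        + (ennreal (f \<theta>0 x y) * indicator {c<..} y) * g (x, c, 0) \<partial>nu)"
      by (rule nn_integral_cong) (auto simp: indicator_def min_def)
    also have "\<dots> = (\<integral>\<^sup>+ y. ennreal (f \<theta>0 x y) * (indicator {..c} y * g (x, y, 1)) \<partial>nu)
        + (\<integral>\<^sup>+ y. (ennreal (f \<theta>0 x y) * indicator {c<..} y) * g (x, c, 0) \<partial>nu)"
      by (rule nn_integral_add) measurable
    also have "(\<integral>\<^sup>+ y. (ennreal (f \<theta>0 x y) * indicator {c<..} y) * g (x, c, 0) \<partial>nu)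
        = ennreal (1 - F \<theta>0 x c) * g (x, c, 0)"
      unfolding ennreal_survival[OF t] by (rule nn_integral_multc) measurable
    finally show "(\<integral>\<^sup>+ y. g (x, min y c, of_bool (y \<le> c)) \<partial>density nu (\<lambda>y. ennreal (f \<theta>0 x y)))
      = (\<integral>\<^sup>+ y. ennreal (f \<theta>0 x y) * (indicator {..c} y * g (x, y, 1)) \<partial>nu)
      + ennreal (1 - F \<theta>0 x c) * g (x, c, 0)" .
  qed
  finally show ?thesis .
qed

section \<open>Kullback-Leibler inequality, identifiability and integrability\<close>

text \<open>
  Multiplying by the ratio replaces the density at \<open>\<theta>0\<close> by the density at \<open>t\<close> in both parts of the
  law of an observation, which then contribute \<open>F t x c\<close> and \<open>1 - F t x c\<close> for every covariate
  and censoring time.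
\<close>

lemma likelihood_ratio_le_1:
  assumes t: "t \<in> \<Theta>"
  shows "(\<integral>\<^sup>+ z. ennreal (exp (l z t - l z \<theta>0)) \<partial>P_obs) \<le> 1"
proof -
  note t0 = true_param
  have [measurable]: "(\<lambda>z. l z t) \<in> borel_measurable (borel \<Otimes>\<^sub>M borel \<Otimes>\<^sub>M borel)"
    "(\<lambda>z. l z \<theta>0) \<in> borel_measurable (borel \<Otimes>\<^sub>M borel \<Otimes>\<^sub>M borel)"
    by (rule obs_loglik_measurable[OF t] obs_loglik_measurable[OF t0])+
  let ?r = "\<lambda>z. ennreal (exp (l z t - l z \<theta>0))"
  have "(\<integral>\<^sup>+ z. ?r z \<partial>P_obs) = (\<integral>\<^sup>+ x. \<integral>\<^sup>+ c.
      (\<integral>\<^sup>+ y. ennreal (f \<theta>0 x y) * (indicator {..c} y * ?r (x, y, 1)) \<partial>nu)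
      + ennreal (1 - F \<theta>0 x c) * ?r (x, c, 0) \<partial>G x \<partial>H)"
    by (rule nn_integral_P_obs) measurable
  also have "\<dots> = (\<integral>\<^sup>+ x. \<integral>\<^sup>+ c. 1 \<partial>G x \<partial>H)"
  proof (rule nn_integral_cong_AE, use AE_regular in eventually_elim, rule nn_integral_cong)
    fix x c assume x: "regular x"
    have "(\<integral>\<^sup>+ y. ennreal (f \<theta>0 x y) * (indicator {..c} y * ?r (x, y, 1)) \<partial>nu)
        = (\<integral>\<^sup>+ y. ennreal (f t x y) * indicator {..c} y \<partial>nu)"
    proof (rule nn_integral_cong_AE)
      show "AE y in nu. ennreal (f \<theta>0 x y) * (indicator {..c} y * ?r (x, y, 1)) = ennreal (f t x y) * indicator {..c} y"
        using x unfolding regular_def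
      proof eventually_elim
        case (elim y)
        then have "0 < f \<theta>0 x y" "0 < f t x y" using t t0 by auto
        then show ?case
          by (auto simp: obs_loglik_def indicator_def exp_diff simp flip: ennreal_mult)
      qed
    qed
    also have "\<dots> = ennreal (F t x c)" by (rule ennreal_cond_cdf[OF t, symmetric])
    finally have uncensored: "(\<integral>\<^sup>+ y. ennreal (f \<theta>0 x y) * (indicator {..c} y * ?r (x, y, 1)) \<partial>nu) = ennreal (F t x c)" .
    have censored: "ennreal (1 - F \<theta>0 x c) * ?r (x, c, 0) = ennreal (1 - F t x c)"
    proof (cases "F \<theta>0 x c = 1")
      case True
      then have "F t x c = 1" using cond_cdf_eq_1_iff[OF x] t t0 by simp
      with True show ?thesis by simp
    next
      case False
      then have "F t x c \<noteq> 1" using cond_cdf_eq_1_iff[OF x] t t0 by simp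
      with False have "0 < 1 - F \<theta>0 x c" "0 < 1 - F t x c"
        using cond_cdf_le_1[OF t, of x c] cond_cdf_le_1[OF t0, of x c] by auto
      then show ?thesis
        by (auto simp: obs_loglik_def log_surv_def exp_diff simp flip: ennreal_mult)
    qed
    show "(\<integral>\<^sup>+ y. ennreal (f \<theta>0 x y) * (indicator {..c} y * ?r (x, y, 1)) \<partial>nu)
      + ennreal (1 - F \<theta>0 x c) * ?r (x, c, 0) = 1"
      unfolding uncensored censored using cond_cdf_le_1[OF t, of x c] cond_cdf_nonneg[OF t, of x c] by (simp flip: ennreal_plus)
  qed
  also have "\<dots> = 1"
    using prob_space.emeasure_space_1[OF prob_space_G] prob_space.emeasure_space_1[OF prob_space_distr[OF X]] by simp
  finally show ?thesis by simp
qed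


text \<open>
  Let \<open>B\<close> be the set where the two densities differ. If the log-likelihoods agree, then \<open>(X, Y)\<close> is
  almost surely outside \<open>B\<close> on the event \<open>Y \<le> C\<close>. Integrating out \<open>C\<close> first, the probability
  \<open>G x {y..}\<close> of observing a value \<open>y\<close> vanishes almost surely on \<open>B\<close>, that is, the left limit of the
  distribution function of \<open>C\<close> is one there.
\<close>

lemma identifiable:
  assumes t: "t \<in> \<Theta>" and eq: "AE z in P_obs. l z t = l z \<theta>0"
  shows "AE w in M. (X w, Y w) \<notin> A_set f G \<theta>0 t"
proof -
  note t0 = true_param
  obtain N where N: "N \<in> null_sets (H \<Otimes>\<^sub>M nu)" and pos: "\<And>x y t. (x, y) \<notin> N \<Longrightarrow> t \<in> \<Theta> \<Longrightarrow> 0 < f t x y"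
    by (rule positive_off_null_set) blast
  let ?K = "\<lambda>x. density nu (\<lambda>y. ennreal (f \<theta>0 x y))"
  have K: "?K \<in> borel \<rightarrow>\<^sub>M prob_algebra borel"
    using law_Y by (simp add: is_cond_distr_def)
  have K_prob: "prob_space (?K x)" for x
    using measurable_space[OF K, of x] by (auto simp: space_prob_algebra)
  have Gk[measurable]: "G \<in> borel \<rightarrow>\<^sub>M subprob_algebra borel"
    by (rule measurable_prob_algebraD[OF kernel_C])
  define B where "B = {z. f \<theta>0 (fst z) (snd z) \<noteq> f t (fst z) (snd z)}"
  have B[measurable]: "B \<in> sets (borel \<Otimes>\<^sub>M borel)"
  proof -
    have "Measurable.pred (borel \<Otimes>\<^sub>M borel) (\<lambda>z. f \<theta>0 (fst z) (snd z) \<noteq> f t (fst z) (snd z))"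
      using density_measurable[OF t measurable_fst measurable_snd] density_measurable[OF t0 measurable_fst measurable_snd]
      by measurable
    then show ?thesis by (simp add: B_def pred_def space_pair_measure)
  qed
  have at_risk[measurable]: "(\<lambda>z. emeasure (G (fst z)) {snd z..}) \<in> borel_measurable (borel \<Otimes>\<^sub>M borel)"
  proof (rule emeasure_measurable_subprob_algebra2[where N = borel])
    show "(\<lambda>z. G (fst z)) \<in> borel \<Otimes>\<^sub>M borel \<rightarrow>\<^sub>M subprob_algebra borel" by measurable
    have "Measurable.pred ((borel \<Otimes>\<^sub>M borel) \<Otimes>\<^sub>M borel) (\<lambda>z :: ((real^'p) \<times> real) \<times> real. snd (fst z) \<le> snd z)" by measurable
    moreover have "(SIGMA z:space (borel \<Otimes>\<^sub>M borel). {snd z..}) = {z :: ((real^'p) \<times> real) \<times> real. snd (fst z) \<le> snd z}"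
      by (auto simp: space_pair_measure)
    ultimately show "(SIGMA z:space (borel \<Otimes>\<^sub>M borel). {snd z..}) \<in> sets ((borel \<Otimes>\<^sub>M borel :: ((real^'p) \<times> real) measure) \<Otimes>\<^sub>M borel)"
      by (simp add: pred_def space_pair_measure)
  qed
  have obs_eq: "AE w in M. l (obs w) t = l (obs w) \<theta>0"
    using eq unfolding P_obs_eq by (rule AE_distrD[OF measurable_obs])
  have "AE w in M. Y w \<le> C w \<longrightarrow> (X w, Y w) \<notin> B"
    using obs_eq AE_not_in_null_set[OF N]
  proof eventually_elim
    case (elim w)
    then show ?case using pos[OF elim(2) t] pos[OF elim(2) t0]
      by (auto simp: obs_loglik_def B_def)
  qed
  then have "(\<integral>\<^sup>+ w. indicator B (X w, Y w) * of_bool (Y w \<le> C w) \<partial>M) = (\<integral>\<^sup>+ w. 0 \<partial>M)"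
    by (intro nn_integral_cong_AE) (auto elim!: eventually_mono simp: indicator_def)
  then have "0 = (\<integral>\<^sup>+ w. indicator B (X w, Y w) * of_bool (Y w \<le> C w) \<partial>M)" by simp
  also have "\<dots> = (\<integral>\<^sup>+ x. \<integral>\<^sup>+ c. \<integral>\<^sup>+ y. indicator B (x, y) * of_bool (y \<le> c) \<partial>?K x \<partial>G x \<partial>H)"
    using nn_integral_cond_law[OF X Y C indep_given_X law_Y law_C,
        of "\<lambda>z. indicator B (fst z, fst (snd z)) * of_bool (fst (snd z) \<le> snd (snd z))"]
    by simp
  \<comment> \<open>the integral over \<open>c\<close> on the right is over a constant; it is kept to match the form of the joint law\<close>
  also have "\<dots> = (\<integral>\<^sup>+ x. \<integral>\<^sup>+ c. \<integral>\<^sup>+ y. indicator B (x, y) * emeasure (G x) {y..} \<partial>?K x \<partial>G x \<partial>H)"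
  proof (rule nn_integral_cong)
    fix x
    interpret Kx: prob_space "?K x" by (rule K_prob)
    interpret Gx: prob_space "G x" by (rule prob_space_G)
    interpret KG: pair_prob_space "?K x" "G x" by unfold_locales
    have "(\<integral>\<^sup>+ c. \<integral>\<^sup>+ y. indicator B (x, y) * of_bool (y \<le> c) \<partial>?K x \<partial>G x)
        = (\<integral>\<^sup>+ y. \<integral>\<^sup>+ c. indicator B (x, y) * of_bool (y \<le> c) \<partial>G x \<partial>?K x)"
      by (rule KG.Fubini') measurable
    also have "\<dots> = (\<integral>\<^sup>+ y. indicator B (x, y) * emeasure (G x) {y..} \<partial>?K x)"
    proof (rule nn_integral_cong)
      fix y
      have "(\<integral>\<^sup>+ c. indicator B (x, y) * of_bool (y \<le> c) \<partial>G x) = (\<integral>\<^sup>+ c. indicator B (x, y) * indicator {y..} c \<partial>G x)"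
        by (rule nn_integral_cong) (auto simp: indicator_def)
      also have "\<dots> = indicator B (x, y) * emeasure (G x) {y..}"
        by (rule nn_integral_cmult_indicator) simp
      finally show "(\<integral>\<^sup>+ c. indicator B (x, y) * of_bool (y \<le> c) \<partial>G x) = indicator B (x, y) * emeasure (G x) {y..}" .
    qed
    finally show "(\<integral>\<^sup>+ c. \<integral>\<^sup>+ y. indicator B (x, y) * of_bool (y \<le> c) \<partial>?K x \<partial>G x)
        = (\<integral>\<^sup>+ c. \<integral>\<^sup>+ y. indicator B (x, y) * emeasure (G x) {y..} \<partial>?K x \<partial>G x)"
      by (simp add: Gx.emeasure_space_1)
  qed
  also have "\<dots> = (\<integral>\<^sup>+ w. indicator B (X w, Y w) * emeasure (G (X w)) {Y w..} \<partial>M)"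
  proof -
    have [measurable]: "(\<lambda>z. emeasure (G (fst z)) {fst (snd z)..}) \<in> borel_measurable (borel \<Otimes>\<^sub>M borel \<Otimes>\<^sub>M borel)"
      using measurable_compose[OF _ at_risk, of "\<lambda>z. (fst z, fst (snd z))" "borel \<Otimes>\<^sub>M borel \<Otimes>\<^sub>M borel"] by simp
    have "(\<lambda>z. indicator B (fst z, fst (snd z)) * emeasure (G (fst z)) {fst (snd z)..})
        \<in> borel_measurable (borel \<Otimes>\<^sub>M borel \<Otimes>\<^sub>M borel)" by measurable
    from nn_integral_cond_law[OF X Y C indep_given_X law_Y law_C this] show ?thesis
      by (simp only: fst_conv snd_conv)
  qed
  finally have "(\<integral>\<^sup>+ w. indicator B (X w, Y w) * emeasure (G (X w)) {Y w..} \<partial>M) = 0" by simp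
  moreover have "(\<lambda>w. emeasure (G (X w)) {Y w..}) \<in> borel_measurable M"
    using measurable_compose[OF _ at_risk, of "\<lambda>w. (X w, Y w)" M] by simp
  ultimately have "AE w in M. indicator B (X w, Y w) * emeasure (G (X w)) {Y w..} = 0"
    by (subst (asm) nn_integral_0_iff_AE) auto
  then show ?thesis
    using AE_not_in_null_set[OF N]
  proof eventually_elim
    case (elim w)
    interpret Gx: prob_space "G (X w)" by (rule prob_space_G)
    interpret Gx: real_distribution "G (X w)" by unfold_locales auto
    show ?case
    proof (cases "(X w, Y w) \<in> B")
      case True
      with elim have "emeasure (G (X w)) {Y w..} = 0" by simp
      moreover have "measure (G (X w)) {..<Y w} = 1 - measure (G (X w)) {Y w..}"
        using Gx.prob_compl[of "{Y w..}"] by (simp add: Compl_eq_Diff_UNIV[symmetric])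
      ultimately have "measure (G (X w)) {..<Y w} = 1"
        by (simp add: measure_def)
      moreover have "Lim (at_left (Y w)) (cdf (G (X w))) = measure (G (X w)) {..<Y w}"
        by (rule tendsto_Lim[OF _ Gx.cdf_at_left]) simp
      ultimately show ?thesis by (simp add: A_set_def)
    next
      case False
      then show ?thesis using pos[OF elim(2) t] by (simp add: A_set_def B_def)
    qed
  qed
qed

text \<open>
  \<open>L_fun\<close> is an iterated integral in which positive and negative contributions may cancel at each
  level, so its finiteness alone does not bound the negative part of the log-likelihood. Once the
  positive part is integrable, each level of integration recovers the negative part up to one more
  copy of the positive part.
\<close>

lemma integrable_loglik_true:
  assumes pos_part: "(\<integral>\<^sup>+ z. ennreal (l z \<theta>0) \<partial>P_obs) < \<infinity>"
    and L: "- \<infinity> < L_fun nu f G H \<theta>0 \<theta>0"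
  shows "integrable P_obs (\<lambda>z. l z \<theta>0)"
proof -
  note t0 = true_param
  let ?f = "f \<theta>0" and ?F = "F \<theta>0" and ?ls = "log_surv nu f \<theta>0"
  have [measurable]: "(\<lambda>z. l z \<theta>0) \<in> borel_measurable (borel \<Otimes>\<^sub>M borel \<Otimes>\<^sub>M borel)"
    by (rule obs_loglik_measurable[OF t0])
  define r where "r x y = ln (?f x y) * ?f x y" for x y
  define pos where "pos x c = (\<integral>\<^sup>+ y. ennreal (of_bool (y \<le> c) * r x y) \<partial>nu)" for x c
  define neg where "neg x c = (\<integral>\<^sup>+ y. ennreal (- (of_bool (y \<le> c) * r x y)) \<partial>nu)" for x c
  define b where "b x c = (1 - ?F x c) * ?ls x c" for x c
  define v where "v x c = enn2ereal (pos x c) - enn2ereal (neg x c) + ereal (b x c)" for x c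
  define u where "u x = ext_integral (G x) (v x)" for x
  have L_eq: "L_fun nu f G H \<theta>0 \<theta>0 = ext_integral H u"
    unfolding L_fun_def u_def v_def b_def pos_def neg_def r_def
    by (simp add: ext_integral_def[of nu] indicator_def)
  have b_nonpos: "b x c \<le> 0" for x c
    using cond_cdf_le_1[OF t0, of x c] cond_cdf_nonneg[OF t0, of x c]
    by (auto simp: b_def log_surv_def intro!: mult_nonneg_nonpos)
  have v_pos: "e2ennreal (v x c) \<le> pos x c" for x c
  proof -
    have "e2ennreal (v x c) \<le> e2ennreal (enn2ereal (pos x c) - enn2ereal (neg x c))"
      unfolding v_def using b_nonpos[of x c] add_left_mono[of "ereal (b x c)" 0 "enn2ereal (pos x c) - enn2ereal (neg x c)"]
      by (intro e2ennreal_mono) simp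
    also have "\<dots> \<le> pos x c" by (simp add: diff_le_self_ennreal)
    finally show ?thesis .
  qed
  \<comment> \<open>if \<open>pos x c\<close> is infinite, the right-hand side is infinite, so no exceptional set has to be excluded\<close>
  have v_neg: "neg x c + ennreal (- b x c) \<le> e2ennreal (- v x c) + pos x c" for x c
  proof (cases "pos x c"; cases "neg x c")
    fix p n :: real assume pn: "0 \<le> p" "pos x c = ennreal p" "0 \<le> n" "neg x c = ennreal n"
    let ?d = "n - p - b x c"
    have "- v x c = ereal ?d" using pn by (simp add: v_def)
    then have d: "e2ennreal (- v x c) = ennreal ?d" by (simp only: e2ennreal_ereal)
    have "neg x c + ennreal (- b x c) = ennreal (n - b x c)"
      using pn b_nonpos[of x c] ennreal_plus[of n "- b x c"] by simp
    also have "\<dots> \<le> ennreal (max 0 ?d + p)" by (rule ennreal_leI) simp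
    also have "\<dots> = ennreal (max 0 ?d) + ennreal p" using pn(1) by (intro ennreal_plus) auto
    also have "ennreal (max 0 ?d) = ennreal ?d" by (cases "0 \<le> ?d") (simp_all add: max_def ennreal_neg)
    finally show ?thesis using pn d by simp
  next
    fix p :: real assume "0 \<le> p" "pos x c = ennreal p" "neg x c = \<top>"
    then show ?thesis by (simp add: v_def)
  qed auto
  have [measurable]: "(\<lambda>z. pos (fst z) (snd z)) \<in> borel_measurable (borel \<Otimes>\<^sub>M borel)"
    "(\<lambda>z. neg (fst z) (snd z)) \<in> borel_measurable (borel \<Otimes>\<^sub>M borel)"
    "(\<lambda>z. b (fst z) (snd z)) \<in> borel_measurable (borel \<Otimes>\<^sub>M borel)"
  proof -
    have nu_cong: "borel_measurable ((borel \<Otimes>\<^sub>M borel) \<Otimes>\<^sub>M nu) = borel_measurable ((borel \<Otimes>\<^sub>M borel) \<Otimes>\<^sub>M borel)"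
      by (intro measurable_cong_sets sets_pair_measure_cong) auto
    have "(\<lambda>z. ?f (fst (fst z)) (snd z)) \<in> borel_measurable ((borel \<Otimes>\<^sub>M borel) \<Otimes>\<^sub>M borel)"
      by (rule density_measurable[OF t0]) measurable
    then have "(\<lambda>z. of_bool (snd z \<le> snd (fst z)) * r (fst (fst z)) (snd z)) \<in> borel_measurable ((borel \<Otimes>\<^sub>M borel) \<Otimes>\<^sub>M borel)"
      unfolding r_def by measurable
    then have r_meas: "(\<lambda>(z, y). ennreal (of_bool (y \<le> snd z) * r (fst z) y)) \<in> borel_measurable ((borel \<Otimes>\<^sub>M borel) \<Otimes>\<^sub>M nu)"
      "(\<lambda>(z, y). ennreal (- (of_bool (y \<le> snd z) * r (fst z) y))) \<in> borel_measurable ((borel \<Otimes>\<^sub>M borel) \<Otimes>\<^sub>M nu)"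
      unfolding nu_cong split_beta by measurable
    show "(\<lambda>z. pos (fst z) (snd z)) \<in> borel_measurable (borel \<Otimes>\<^sub>M borel)"
      "(\<lambda>z. neg (fst z) (snd z)) \<in> borel_measurable (borel \<Otimes>\<^sub>M borel)"
      unfolding pos_def neg_def
      by (rule nu.borel_measurable_nn_integral[OF r_meas(1)], rule nu.borel_measurable_nn_integral[OF r_meas(2)])
    show "(\<lambda>z. b (fst z) (snd z)) \<in> borel_measurable (borel \<Otimes>\<^sub>M borel)"
      unfolding b_def
      by (intro borel_measurable_times borel_measurable_diff borel_measurable_const cond_cdf_measurable[OF t0] log_surv_measurable[OF t0]
          measurable_fst measurable_snd)
  qed
  have v_meas[measurable]: "(\<lambda>z. v (fst z) (snd z)) \<in> borel_measurable (borel \<Otimes>\<^sub>M borel)"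
    unfolding v_def by measurable
  have Gk[measurable]: "G \<in> borel \<rightarrow>\<^sub>M subprob_algebra borel"
    by (rule measurable_prob_algebraD[OF kernel_C])
  have G_int[measurable]: "(\<lambda>x. \<integral>\<^sup>+ c. g (x, c) \<partial>G x) \<in> borel_measurable borel"
    if "g \<in> borel_measurable (borel \<Otimes>\<^sub>M borel)" for g
    using that by (intro nn_integral_measurable_subprob_algebra2[where N = borel] Gk) (simp add: split_beta')
  have sec[measurable]: "pos x \<in> borel_measurable borel" "neg x \<in> borel_measurable borel"
    "b x \<in> borel_measurable borel" "v x \<in> borel_measurable borel" for x
  proof -
    have sec: "g x \<in> borel_measurable borel" if "(\<lambda>z. g (fst z) (snd z)) \<in> borel_measurable (borel \<Otimes>\<^sub>M borel)"
      for g :: "real^'p \<Rightarrow> real \<Rightarrow> 'e::topological_space"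
      using measurable_compose[OF measurable_Pair1' that, of x] by simp
    show "pos x \<in> borel_measurable borel" "neg x \<in> borel_measurable borel"
      "b x \<in> borel_measurable borel" "v x \<in> borel_measurable borel"
      by (rule sec, measurable)+
  qed
  have u_meas[measurable]: "u \<in> borel_measurable borel"
    unfolding u_def ext_integral_def
    using G_int[of "\<lambda>z. e2ennreal (v (fst z) (snd z))"] G_int[of "\<lambda>z. e2ennreal (- v (fst z) (snd z))"] by simp
  define pp where "pp x = (\<integral>\<^sup>+ c. pos x c \<partial>G x)" for x
  have pp_meas[measurable]: "pp \<in> borel_measurable borel"
    unfolding pp_def using G_int[of "\<lambda>z. pos (fst z) (snd z)"] by simp
  have inner: "(\<integral>\<^sup>+ c. neg x c + ennreal (- b x c) \<partial>G x) \<le> e2ennreal (- u x) + (pp x + pp x)" for x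
  proof -
    have "(\<integral>\<^sup>+ c. neg x c + ennreal (- b x c) \<partial>G x) \<le> (\<integral>\<^sup>+ c. e2ennreal (- v x c) + pos x c \<partial>G x)"
      by (rule nn_integral_mono) (rule v_neg)
    also have "\<dots> = (\<integral>\<^sup>+ c. e2ennreal (- v x c) \<partial>G x) + pp x"
      unfolding pp_def by (rule nn_integral_add) measurable
    also have "\<dots> \<le> e2ennreal (- u x) + (\<integral>\<^sup>+ c. e2ennreal (v x c) \<partial>G x) + pp x"
      unfolding u_def by (intro add_right_mono negative_part_le_ext_integral)
    also have "(\<integral>\<^sup>+ c. e2ennreal (v x c) \<partial>G x) \<le> pp x"
      unfolding pp_def by (rule nn_integral_mono) (rule v_pos)
    finally show ?thesis by (simp add: add.assoc add_mono)
  qed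
  have u_pos: "e2ennreal (u x) \<le> pp x" for x
    unfolding u_def pp_def
    by (rule order_trans[OF e2ennreal_ext_integral_le]) (intro nn_integral_mono v_pos)
  have f_nonneg: "AE y in nu. 0 \<le> ?f x y" for x
    using AE_nu_nonneg by eventually_elim (simp add: density_nonneg t0)
  have pp_fin: "(\<integral>\<^sup>+ x. pp x \<partial>H) < \<infinity>"
  proof -
    have "(\<integral>\<^sup>+ x. pp x \<partial>H) \<le> (\<integral>\<^sup>+ x. \<integral>\<^sup>+ c.
      (\<integral>\<^sup>+ y. ennreal (f \<theta>0 x y) * (indicator {..c} y * ennreal (l (x, y, 1) \<theta>0)) \<partial>nu)
      + ennreal (1 - F \<theta>0 x c) * ennreal (l (x, c, 0) \<theta>0) \<partial>G x \<partial>H)"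
      unfolding pp_def
    proof (intro nn_integral_mono)
      fix x c
      have "pos x c = (\<integral>\<^sup>+ y. ennreal (f \<theta>0 x y) * (indicator {..c} y * ennreal (l (x, y, 1) \<theta>0)) \<partial>nu)"
        unfolding pos_def
        by (rule nn_integral_cong_AE, use f_nonneg[of x] in eventually_elim)
          (auto simp: r_def obs_loglik_def indicator_def mult.commute simp flip: ennreal_mult')
      then show "pos x c \<le> (\<integral>\<^sup>+ y. ennreal (f \<theta>0 x y) * (indicator {..c} y * ennreal (l (x, y, 1) \<theta>0)) \<partial>nu)
          + ennreal (1 - F \<theta>0 x c) * ennreal (l (x, c, 0) \<theta>0)" by simp
    qed
    also have "\<dots> = (\<integral>\<^sup>+ z. ennreal (l z \<theta>0) \<partial>P_obs)"
      by (rule nn_integral_P_obs[symmetric]) measurable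
    finally show ?thesis using pos_part by simp
  qed
  have "(\<integral>\<^sup>+ z. ennreal (- l z \<theta>0) \<partial>P_obs) = (\<integral>\<^sup>+ x. \<integral>\<^sup>+ c.
      (\<integral>\<^sup>+ y. ennreal (f \<theta>0 x y) * (indicator {..c} y * ennreal (- l (x, y, 1) \<theta>0)) \<partial>nu)
      + ennreal (1 - F \<theta>0 x c) * ennreal (- l (x, c, 0) \<theta>0) \<partial>G x \<partial>H)"
    by (rule nn_integral_P_obs) measurable
  also have "\<dots> = (\<integral>\<^sup>+ x. \<integral>\<^sup>+ c. neg x c + ennreal (- b x c) \<partial>G x \<partial>H)"
  proof (intro nn_integral_cong arg_cong2[where f = "(+)"])
    fix x c
    show "(\<integral>\<^sup>+ y. ennreal (f \<theta>0 x y) * (indicator {..c} y * ennreal (- l (x, y, 1) \<theta>0)) \<partial>nu) = neg x c"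
      unfolding neg_def
      by (rule nn_integral_cong_AE, use f_nonneg[of x] in eventually_elim)
        (auto simp: r_def obs_loglik_def indicator_def mult.commute simp flip: ennreal_mult')
    show "ennreal (1 - F \<theta>0 x c) * ennreal (- l (x, c, 0) \<theta>0) = ennreal (- b x c)"
      using cond_cdf_le_1[OF t0, of x c] by (simp add: b_def obs_loglik_def flip: ennreal_mult')
  qed
  also have "\<dots> \<le> (\<integral>\<^sup>+ x. e2ennreal (- u x) + (pp x + pp x) \<partial>H)"
    by (rule nn_integral_mono) (rule inner)
  also have "\<dots> = (\<integral>\<^sup>+ x. e2ennreal (- u x) \<partial>H) + ((\<integral>\<^sup>+ x. pp x \<partial>H) + (\<integral>\<^sup>+ x. pp x \<partial>H))"
    by (simp add: nn_integral_add)
  also have "\<dots> \<le> e2ennreal (- ext_integral H u) + (\<integral>\<^sup>+ x. e2ennreal (u x) \<partial>H) + ((\<integral>\<^sup>+ x. pp x \<partial>H) + (\<integral>\<^sup>+ x. pp x \<partial>H))"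
    by (intro add_right_mono negative_part_le_ext_integral)
  also have "\<dots> < \<infinity>"
  proof -
    have "(\<integral>\<^sup>+ x. e2ennreal (u x) \<partial>H) \<le> (\<integral>\<^sup>+ x. pp x \<partial>H)"
      by (rule nn_integral_mono) (rule u_pos)
    then have "(\<integral>\<^sup>+ x. e2ennreal (u x) \<partial>H) < \<infinity>" using pp_fin by (rule le_less_trans)
    moreover have "e2ennreal (- ext_integral H u) < \<infinity>"
      using L unfolding L_eq by (cases "ext_integral H u") (auto simp: e2ennreal_neg)
    ultimately show ?thesis using pp_fin by simp
  qed
  finally have "(\<integral>\<^sup>+ z. ennreal (- l z \<theta>0) \<partial>P_obs) < \<infinity>" .
  with pos_part show ?thesis
    unfolding real_integrable_def by auto
qed

end

section \<open>Consistency of the maximum likelihood estimator\<close>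

text \<open>
  It remains to move the bound on local suprema from the sample space to the law of an observation,
  where the supremum is replaced by an almost surely equal measurable function. Applied at \<open>\<theta>0\<close>, it
  also yields integrability of the positive part of the log-likelihood.
\<close>

theorem theorem4:
  fixes M :: "'w measure"
    and nu :: "real measure"
    and \<Theta> :: "(real^'q) set"
    and f :: "real^'q \<Rightarrow> real^'p \<Rightarrow> real \<Rightarrow> real"
    and \<theta>0 :: "real^'q"
    and X :: "'w \<Rightarrow> real^'p"
    and Y C :: "'w \<Rightarrow> real"
    and G :: "real^'p \<Rightarrow> real measure"
    and Xs :: "nat \<Rightarrow> 'w \<Rightarrow> real^'p"
    and Zs ds :: "nat \<Rightarrow> 'w \<Rightarrow> real"
    and \<theta>hat :: "nat \<Rightarrow> 'w \<Rightarrow> real^'q"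
  assumes "prob_space M"
    and nu: "sets nu = sets borel" "sigma_finite_measure nu" "emeasure nu {..<0} = 0"
    and family: "density_family nu (distr M borel X) \<Theta> f"
    and true_param: "\<theta>0 \<in> \<Theta>"
    and rvs: "X \<in> borel_measurable M" "Y \<in> borel_measurable M" "C \<in> borel_measurable M"
    and nonneg: "AE w in M. 0 \<le> Y w" "AE w in M. 0 \<le> C w"
    and indep_given_X: "cond_indep M X Y C"
    and law_Y: "is_cond_distr M X Y (\<lambda>x. density nu (\<lambda>y. ennreal (f \<theta>0 x y)))"
    and law_C: "is_cond_distr M X C G"
    and obs_indep: "prob_space.indep_vars M (\<lambda>_. borel) (\<lambda>i w. (Xs i w, Zs i w, ds i w)) UNIV"
    and obs_law: "\<And>i. distr M borel (\<lambda>w. (Xs i w, Zs i w, ds i w))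
                     = distr M borel (\<lambda>w. (X w, min (Y w) (C w), of_bool (Y w \<le> C w)))"
    and a: "\<bar>L_fun nu f G (distr M borel X) \<theta>0 \<theta>0\<bar> < \<infinity>"
    and b: "\<And>\<theta>. \<theta> \<in> \<Theta> - {\<theta>0} \<Longrightarrow> measure M {w \<in> space M. (X w, Y w) \<in> A_set f G \<theta>0 \<theta>} > 0"
    and c: "\<And>x y. 0 \<le> y \<Longrightarrow> continuous_on \<Theta> (\<lambda>\<theta>. f \<theta> x y)"
    and d: "compact \<Theta>"
    and e: "\<And>\<theta>s. \<theta>s \<in> \<Theta> \<Longrightarrow> \<exists>V. openin (top_of_set \<Theta>) V \<and> \<theta>s \<in> V \<and>
              ext_integral M (\<lambda>w. SUP \<theta>\<in>V. ereal (loglik nu f Xs Zs ds 1 w \<theta>)) < \<infinity>"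
    and maximizer: "AE w in M. \<forall>n\<ge>1. is_arg_max (loglik nu f Xs Zs ds n w) (\<lambda>\<theta>. \<theta> \<in> \<Theta>) (\<theta>hat n w)"
  shows "AE w in M. (\<lambda>n. \<theta>hat n w) \<longlonglongrightarrow> \<theta>0"
proof -
  interpret prob_space M by fact
  interpret censored_regression M nu \<Theta> f \<theta>0 X Y C G
    by (intro censored_regression.intro censored_regression_axioms.intro)
      (fact \<open>prob_space M\<close> nu family true_param rvs indep_given_X law_Y law_C c)+
  interpret P: prob_space P_obs by (rule prob_space_P_obs)
  let ?W = "\<lambda>i w. (Xs i w, Zs i w, ds i w)"
  have W: "?W i \<in> borel_measurable M" for i
    using obs_indep unfolding indep_vars_def by auto
  have law: "distr M borel (?W i) = P_obs" for i
    using obs_law[of i] by (simp add: P_obs_def)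
  have meas: "(\<lambda>z. obs_loglik nu f z t) \<in> borel_measurable P_obs" if "t \<in> \<Theta>" for t
    using obs_loglik_measurable[OF that] by simp
  have sup: "\<exists>V. openin (top_of_set \<Theta>) V \<and> t \<in> V
      \<and> (\<integral>\<^sup>+ z. e2ennreal (SUP s\<in>V. ereal (obs_loglik nu f z s)) \<partial>P_obs) < \<infinity>" if t: "t \<in> \<Theta>" for t
  proof -
    from e[OF t] obtain V where V: "openin (top_of_set \<Theta>) V" "t \<in> V"
      and fin: "ext_integral M (\<lambda>w. SUP s\<in>V. ereal (loglik nu f Xs Zs ds 1 w s)) < \<infinity>" by blast
    have V_sub: "V \<subseteq> \<Theta>" using V(1) by (rule openin_imp_subset)
    obtain S where S: "S \<in> borel_measurable P_obs"
      and S_eq: "\<And>z. continuous_on V (obs_loglik nu f z) \<Longrightarrow> (SUP s\<in>V. ereal (obs_loglik nu f z s)) = S z"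
      by (rule measurable_SUP_continuous[of V "obs_loglik nu f" P_obs]) (use V_sub meas in auto)
    have AE_S: "AE z in P_obs. (SUP s\<in>V. ereal (obs_loglik nu f z s)) = S z"
      using AE_obs_loglik_continuous by eventually_elim (rule S_eq, erule continuous_on_subset, rule V_sub)
    have W': "?W 0 \<in> M \<rightarrow>\<^sub>M P_obs"
      using W[of 0] by (simp flip: law[of 0])
    have "distr M P_obs (?W 0) = P_obs"
      using distr_cong[of M M P_obs borel "?W 0" "?W 0"] law[of 0] by (simp add: P_obs_def)
    then have "(\<integral>\<^sup>+ z. e2ennreal (S z) \<partial>P_obs) = (\<integral>\<^sup>+ w. e2ennreal (S (?W 0 w)) \<partial>M)"
      using nn_integral_distr[OF W', of "\<lambda>z. e2ennreal (S z)"] S by simp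
    moreover have "(\<integral>\<^sup>+ z. e2ennreal (SUP s\<in>V. ereal (obs_loglik nu f z s)) \<partial>P_obs) = (\<integral>\<^sup>+ z. e2ennreal (S z) \<partial>P_obs)"
      by (rule nn_integral_cong_AE) (use AE_S in eventually_elim, simp)
    moreover have "(\<integral>\<^sup>+ w. e2ennreal (S (?W 0 w)) \<partial>M)
        = (\<integral>\<^sup>+ w. e2ennreal (SUP s\<in>V. ereal (loglik nu f Xs Zs ds 1 w s)) \<partial>M)"
    proof (rule nn_integral_cong_AE)
      have "AE w in M. (SUP s\<in>V. ereal (obs_loglik nu f (?W 0 w) s)) = S (?W 0 w)"
        by (rule AE_distrD[OF W[of 0]]) (simp only: law AE_S)
      then show "AE w in M. e2ennreal (S (?W 0 w)) = e2ennreal (SUP s\<in>V. ereal (loglik nu f Xs Zs ds 1 w s))"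
        by eventually_elim (simp add: loglik_eq_sum_obs_loglik)
    qed
    moreover have "(\<integral>\<^sup>+ w. e2ennreal (SUP s\<in>V. ereal (loglik nu f Xs Zs ds 1 w s)) \<partial>M) < \<infinity>"
    proof (rule ccontr)
      assume "\<not> ?thesis"
      then have "ext_integral M (\<lambda>w. SUP s\<in>V. ereal (loglik nu f Xs Zs ds 1 w s)) = \<infinity>"
        by (simp add: ext_integral_def not_less top_unique)
      with fin show False by simp
    qed
    ultimately show ?thesis using V by auto
  qed
  show ?thesis
  proof (rule wald_consistency[OF obs_indep law meas AE_obs_loglik_continuous d true_param _ likelihood_ratio_le_1 _ sup])
    from sup[OF true_param] obtain V where V: "\<theta>0 \<in> V"
        "(\<integral>\<^sup>+ z. e2ennreal (SUP s\<in>V. ereal (obs_loglik nu f z s)) \<partial>P_obs) < \<infinity>" by blast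
    have "ennreal (obs_loglik nu f z \<theta>0) \<le> e2ennreal (SUP s\<in>V. ereal (obs_loglik nu f z s))" for z
      using e2ennreal_mono[OF SUP_upper[OF V(1), of "\<lambda>s. ereal (obs_loglik nu f z s)"]] by simp
    then have "(\<integral>\<^sup>+ z. ennreal (obs_loglik nu f z \<theta>0) \<partial>P_obs) < \<infinity>"
      by (intro le_less_trans[OF nn_integral_mono V(2)]) auto
    then show "integrable P_obs (\<lambda>z. obs_loglik nu f z \<theta>0)"
      using a by (intro integrable_loglik_true) auto
  next
    fix t assume t: "t \<in> \<Theta> - {\<theta>0}"
    show "\<not> (AE z in P_obs. obs_loglik nu f z t = obs_loglik nu f z \<theta>0)"
    proof
      assume "AE z in P_obs. obs_loglik nu f z t = obs_loglik nu f z \<theta>0"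
      with t have "AE w in M. (X w, Y w) \<notin> A_set f G \<theta>0 t" by (intro identifiable) auto
      \<comment> \<open>if the event is not measurable, its measure is zero by convention\<close>
      then have "measure M {w \<in> space M. (X w, Y w) \<in> A_set f G \<theta>0 t} = 0"
        using AE_iff_null[of M "\<lambda>w. (X w, Y w) \<notin> A_set f G \<theta>0 t"]
        by (cases "{w \<in> space M. (X w, Y w) \<in> A_set f G \<theta>0 t} \<in> sets M")
          (auto intro: measure_eq_0_null_sets measure_notin_sets)
      with b[OF t] show False by simp
    qed
  next
    show "AE w in M. \<forall>n\<ge>1. is_arg_max (\<lambda>t. \<Sum>i<n. obs_loglik nu f (?W i w) t) (\<lambda>t. t \<in> \<Theta>) (\<theta>hat n w)"
      using maximizer by (simp add: loglik_eq_sum_obs_loglik[abs_def])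
  qed auto
qed

end
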